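(* Let $L\in\mathcal M(2,\mathbb Z)$ be an integer expansion matrix, and let $\vec N(\overleftarrow{\mathbb Z^2}_{(L^n)})\subseteq GL(2,\mathbb Z)$ denote the linear representation group of the constant-base odometer $\overleftarrow{\mathbb Z^2}_{(L^n)}$. (1) If $\operatorname{rad}(\det L)$ divides $\operatorname{trace}(L)$, then $\vec N(\overleftarrow{\mathbb Z^2}_{(L^n)})=GL(2,\mathbb Z)$. (2) Suppose $\operatorname{rad}(\det L)$ does not divide $\operatorname{trace}(L)$. (a) If no eigenvalue of $L$ is an integer, then $\vec N(\overleftarrow{\mathbb Z^2}_{(L^n)})=\operatorname{Cent}_{GL(2,\mathbb Z)}(L)$. Moreover, if no eigenvalue of $L$ is real, then $\vec N(\overleftarrow{\mathbb Z^2}_{(L^n)})$ is a finite group. (b) If some eigenvalue of $L$ is an integer, then $\vec N(\overleftarrow{\mathbb Z^2}_{(L^n)})$ is finite or virtually $\mathbb Z$. More precisely, at least one of the following holds: $\vec N(\overleftarrow{\mathbb Z^2}_{(L^n)})$ is isomorphic to $\mathbb Z/2\mathbb Z$; or it is isomorphic to $\mathbb Z^2/(2\mathbb Z\times 2\mathbb Z)$; or its commutator subgroup is cyclic and its abelianization is finite.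
   Context: An integer matrix is an expansion if all its eigenvalues have modulus strictly greater than $1$. For an integer $n$ with $|n|>1$, $\operatorname{rad}(n)$ is the product of the distinct primes dividing $n$. $\operatorname{Cent}_{GL(2,\mathbb Z)}(L)$ is the group of all matrices in $GL(2,\mathbb Z)$ commuting with $L$. A group is virtually $\mathbb Z$ if it has an infinite cyclic subgroup of finite index. For an expansion matrix $L\in\mathcal M(d,\mathbb Z)$, the constant-base odometer $\overleftarrow{\mathbb Z^d}_{(L^n)}$ is the inverse limit $\varprojlim_n \mathbb Z^d/L^n(\mathbb Z^d)$ (with the natural projections $\mathbb Z^d/L^{n+1}(\mathbb Z^d)\to\mathbb Z^d/L^n(\mathbb Z^d)$), a compact topological group, with the $\mathbb Z^d$-action ${\bm n}{\bm +}\overleftarrow g=\kappa({\bm n})+\overleftarrow g$, where $\kappa({\bm n})=({\bm n}\bmod L^n(\mathbb Z^d))_{n\ge0}$. For a topological dynamical system $(X,T,\mathbb Z^d)$ (a continuous $\mathbb Z^d$-action on a compact metric space) and $M\in GL(d,\mathbb Z)$, an $M$-endomorphism is a continuous surjective map $\phi:X\to X$ with $\phi\circ T^{\bm n}=T^{M{\bm n}}\circ\phi$ for all ${\bm n}\in\mathbb Z^d$. The linear representation semigroup is $\vec N(X,T)=\{M\in GL(d,\mathbb Z):\text{ there exists an } M\text{-endomorphism of }(X,T,\mathbb Z^d)\}$; for odometers it is a group, called the linear representation group. *)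

theory Defs
  imports
    "HOL-Analysis.Analysis"
    "HOL-Algebra.Elementary_Groups"
    "HOL-Algebra.Product_Groups"
    "HOL-Algebra.Generated_Groups"
    "HOL-Computational_Algebra.Primes"
begin

definition is_eigenvalue :: "int ^ 'd ^ 'd \<Rightarrow> complex \<Rightarrow> bool" where
  "is_eigenvalue A z \<longleftrightarrow>
     (\<exists>v. v \<noteq> 0 \<and> (map_matrix of_int A :: complex ^ 'd ^ 'd) *v v = z *s v)"

definition expansion :: "int ^ 'd ^ 'd \<Rightarrow> bool" where
  "expansion A \<longleftrightarrow> (\<forall>z. is_eigenvalue A z \<longrightarrow> norm z > 1)"

text \<open>The operation \<open>^\<close> on \<open>int ^ 'd ^ 'd\<close> would be the componentwise power.\<close>

definition matrix_pow :: "int ^ 'd ^ 'd \<Rightarrow> nat \<Rightarrow> int ^ 'd ^ 'd" where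
  "matrix_pow A n = ((**) A ^^ n) (mat 1)"

definition rad :: "int \<Rightarrow> int" where
  "rad n = \<Prod>(prime_factors n)"

definition GL_int :: "(int ^ 'd ^ 'd) monoid" where
  "GL_int = \<lparr>carrier = {M. invertible M}, monoid.mult = (**), one = mat 1\<rparr>"

definition Cent_GL :: "int ^ 'd ^ 'd \<Rightarrow> (int ^ 'd ^ 'd) set" where
  "Cent_GL L = {M \<in> carrier GL_int. M ** L = L ** M}"

definition virtually_Z :: "('a, 'b) monoid_scheme \<Rightarrow> bool" where
  "virtually_Z G \<longleftrightarrow> group G \<and>
     (\<exists>H. subgroup H G \<and> cyclic_group (G\<lparr>carrier := H\<rparr>) \<and> infinite H \<and> finite (rcosets\<^bsub>G\<^esub> H))"

definition commutator_subgroup :: "('a, 'b) monoid_scheme \<Rightarrow> ('a, 'b) monoid_scheme" where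
  "commutator_subgroup G = G\<lparr>carrier := derived G (carrier G)\<rparr>"

definition abelianization :: "('a, 'b) monoid_scheme \<Rightarrow> 'a set monoid" where
  "abelianization G = G Mod (derived G (carrier G))"

text \<open>A dynamical system is given by a topology \<open>X\<close>, whose points are those of \<open>topspace X\<close>,
  and an action \<open>T\<close> of \<open>int ^ 'd\<close> on them.\<close>

definition M_endomorphism ::
  "'a topology \<Rightarrow> (int ^ 'd \<Rightarrow> 'a \<Rightarrow> 'a) \<Rightarrow> int ^ 'd ^ 'd \<Rightarrow> ('a \<Rightarrow> 'a) \<Rightarrow> bool" where
  "M_endomorphism X T M \<phi> \<longleftrightarrow>
     continuous_map X X \<phi> \<and> \<phi> ` topspace X = topspace X \<and>
     (\<forall>n. \<forall>x \<in> topspace X. \<phi> (T n x) = T (M *v n) (\<phi> x))"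

definition linear_rep :: "'a topology \<Rightarrow> (int ^ 'd \<Rightarrow> 'a \<Rightarrow> 'a) \<Rightarrow> (int ^ 'd ^ 'd) set" where
  "linear_rep X T = {M \<in> carrier GL_int. \<exists>\<phi>. M_endomorphism X T M \<phi>}"

definition Zd :: "(int ^ 'd) monoid" where
  "Zd = \<lparr>carrier = UNIV, monoid.mult = (+), one = 0\<rparr>"

definition sublattice :: "int ^ 'd ^ 'd \<Rightarrow> nat \<Rightarrow> (int ^ 'd) set" where
  "sublattice L n = range ((*v) (matrix_pow L n))"

definition lattice_quotient :: "int ^ 'd ^ 'd \<Rightarrow> nat \<Rightarrow> (int ^ 'd) set monoid" where
  "lattice_quotient L n = Zd Mod sublattice L n"

text \<open>The natural projection from \<open>lattice_quotient L (Suc n)\<close> to \<open>lattice_quotient L n\<close>;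
  it sends a coset \<open>C\<close> to the sumset of \<open>C\<close> and \<open>sublattice L n\<close>.\<close>

definition quotient_proj :: "int ^ 'd ^ 'd \<Rightarrow> nat \<Rightarrow> (int ^ 'd) set \<Rightarrow> (int ^ 'd) set" where
  "quotient_proj L n C = C <#>\<^bsub>Zd\<^esub> sublattice L n"

definition odometer_group :: "int ^ 'd ^ 'd \<Rightarrow> (nat \<Rightarrow> (int ^ 'd) set) monoid" where
  "odometer_group L = (product_group UNIV (lattice_quotient L))
     \<lparr>carrier := {g \<in> carrier (product_group UNIV (lattice_quotient L)).
                    \<forall>n. quotient_proj L n (g (Suc n)) = g n}\<rparr>"

definition odometer_topology :: "int ^ 'd ^ 'd \<Rightarrow> (nat \<Rightarrow> (int ^ 'd) set) topology" where
  "odometer_topology L = subtopology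
     (product_topology (\<lambda>n. discrete_topology (carrier (lattice_quotient L n))) UNIV)
     (carrier (odometer_group L))"

definition odometer_kappa :: "int ^ 'd ^ 'd \<Rightarrow> int ^ 'd \<Rightarrow> nat \<Rightarrow> (int ^ 'd) set" where
  "odometer_kappa L x = (\<lambda>n. sublattice L n #>\<^bsub>Zd\<^esub> x)"

definition odometer_action ::
  "int ^ 'd ^ 'd \<Rightarrow> int ^ 'd \<Rightarrow> (nat \<Rightarrow> (int ^ 'd) set) \<Rightarrow> (nat \<Rightarrow> (int ^ 'd) set)" where
  "odometer_action L x g = odometer_kappa L x \<otimes>\<^bsub>odometer_group L\<^esub> g"

definition odometer_linear_rep :: "int ^ 'd ^ 'd \<Rightarrow> (int ^ 'd ^ 'd) set" where
  "odometer_linear_rep L = linear_rep (odometer_topology L) (odometer_action L)"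

definition odometer_linear_rep_group :: "int ^ 'd ^ 'd \<Rightarrow> (int ^ 'd ^ 'd) monoid" where
  "odometer_linear_rep_group L = GL_int\<lparr>carrier := odometer_linear_rep L\<rparr>"

end

theory Submission
  imports Defs "HOL-Computational_Algebra.Group_Closure"
begin

text \<open>
  Let \<open>det L \<noteq> 0\<close>. A matrix \<open>M\<close> of \<open>GL(2, \<int>)\<close> belongs to the linear representation group of
  the odometer of \<open>L\<close> exactly if for every \<open>n\<close> there is an \<open>m\<close> such that \<open>M\<close> maps \<open>L\<^sup>m(\<int>\<^sup>2)\<close> into \<open>L\<^sup>n(\<int>\<^sup>2)\<close>
  (\<open>lattice_compatible\<close>). Necessity is continuity of an endomorphism at the origin. For sufficiency,
  \<open>M\<close> and \<open>M\<^sup>-\<^sup>1\<close> both induce maps on the inverse limit; the condition passes to \<open>M\<^sup>-\<^sup>1\<close> because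
  \<open>M\<^sup>-\<^sup>1\<close> is congruent to a power of \<open>M\<close> modulo any given integer
  (\<open>odometer_linear_rep_eq\<close>). The rest is arithmetic of \<open>2 \<times> 2\<close> matrices, one prime divisor of
  \<open>det L\<close> at a time.

  If all primes dividing \<open>det L\<close> divide \<open>trace L\<close>, then \<open>L\<close> is nilpotent modulo each of them, the
  lattices \<open>L\<^sup>m(\<int>\<^sup>2)\<close> shrink into arbitrarily divisible multiples of \<open>\<int>\<^sup>2\<close>, and there is no condition
  on \<open>M\<close> (\<open>lattice_compatible_if_rad_dvd_trace\<close>). Otherwise there is a prime \<open>p\<close> dividing \<open>det L\<close> but
  not \<open>trace L\<close>. Then \<open>L\<close> has one \<open>p\<close>-adic eigenvalue that is a unit, and \<open>M\<close> has to preserve its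
  eigenline. Rather than with \<open>p\<close>-adic numbers, the argument works with congruences modulo \<open>p\<^sup>n\<close>
  for all \<open>n\<close>: two vectors of \<open>L\<^sup>n(\<int>\<^sup>2)\<close> span a parallelogram of area divisible by \<open>(det L)\<^sup>n\<close>, and
  an integer divisible by all powers of \<open>p\<close> is zero.

  Without integer eigenvalues the eigenline is irrational. Sharing it with \<open>L\<close> makes the commutator
  \<open>L M - M L\<close> singular (\<open>det_commutator_eq_0\<close>), and a nonzero singular commutator would have a
  rational kernel invariant under \<open>L\<close>; so \<open>M\<close> commutes with \<open>L\<close>. If the eigenvalues are not
  real, the matrices of determinant \<open>\<plusminus>1\<close> commuting with \<open>L\<close> satisfy a definite quadratic equation and
  are finite in number.

  With integer eigenvalues \<open>l\<close> and \<open>l'\<close>, where \<open>p\<close> divides \<open>l'\<close> but not \<open>l\<close>, the eigenline is spanned by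
  a primitive integer vector \<open>v\<close>, and \<open>M v = \<plusminus>v\<close>. Either some prime plays the same role for the other
  eigenline, and \<open>M\<close> is determined by two signs; or this is the only condition
  (\<open>lattice_compatible_if_line_stabilizer\<close>), and the group consists of the triangular matrices with
  diagonal entries \<open>\<plusminus>1\<close> in a basis starting with \<open>v\<close>. In both situations commutators are
  unitriangular, so the derived subgroup is cyclic; in the second it contains the even transvections
  and thus has finite index (\<open>line_stabilizer_virtually_Z\<close>). The proof of the trichotomy
  therefore always arrives at its last alternative, a cyclic commutator subgroup with finite
  abelianization.
\<close>

section \<open>Powers of a matrix and their image lattices\<close>

lemma matrix_pow_0 [simp]: "matrix_pow A 0 = mat 1"
  by (simp add: matrix_pow_def)

lemma matrix_pow_Suc [simp]: "matrix_pow A (Suc n) = A ** matrix_pow A n"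
  by (simp add: matrix_pow_def)

lemma matrix_pow_add: "matrix_pow A (m + n) = matrix_pow A m ** matrix_pow A n"
  by (induction m) (simp_all add: matrix_mul_assoc)

lemma sublattice_0: "0 \<in> sublattice L n"
  unfolding sublattice_def by (rule range_eqI[of _ _ 0]) simp

lemma sublattice_add: "x \<in> sublattice L n \<Longrightarrow> y \<in> sublattice L n \<Longrightarrow> x + y \<in> sublattice L n"
  by (auto simp: sublattice_def matrix_vector_right_distrib[symmetric])

lemma sublattice_diff: "x \<in> sublattice L n \<Longrightarrow> y \<in> sublattice L n \<Longrightarrow> x - y \<in> sublattice L n"
  by (auto simp: sublattice_def matrix_vector_mult_diff_distrib[symmetric])

lemma sublattice_minus: "x \<in> sublattice L n \<Longrightarrow> - x \<in> sublattice L n"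
  using sublattice_diff[OF sublattice_0] by fastforce

lemma sublattice_antimono: "m \<le> n \<Longrightarrow> sublattice L n \<subseteq> sublattice L m"
  by (auto simp: sublattice_def matrix_pow_add matrix_vector_mul_assoc[symmetric] dest!: le_Suc_ex)

section \<open>Points of the odometer as nested sequences of cosets\<close>

lemma odometer_kappa_eq: "odometer_kappa L x n = {y. y - x \<in> sublattice L n}"
  by (auto simp: odometer_kappa_def r_coset_def Zd_def algebra_simps intro!: bexI[of _ "_ - x"])

lemma odometer_kappa_eq_iff: "odometer_kappa L x n = odometer_kappa L y n \<longleftrightarrow> x - y \<in> sublattice L n"
proof
  assume "odometer_kappa L x n = odometer_kappa L y n"
  moreover have "x \<in> odometer_kappa L x n"
    by (simp add: odometer_kappa_eq sublattice_0)
  ultimately show "x - y \<in> sublattice L n"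
    by (simp add: odometer_kappa_eq)
next
  assume *: "x - y \<in> sublattice L n"
  have "z - x \<in> sublattice L n \<longleftrightarrow> z - y \<in> sublattice L n" for z
    using sublattice_add[OF _ *, of "z - x"] sublattice_diff[OF _ *, of "z - y"] by auto
  then show "odometer_kappa L x n = odometer_kappa L y n"
    by (simp add: odometer_kappa_eq)
qed

lemma set_mult_kappa:
  "odometer_kappa L x n <#>\<^bsub>Zd\<^esub> odometer_kappa L y n = odometer_kappa L (x + y) n"
proof -
  have "z - (x + y) \<in> sublattice L n \<Longrightarrow>
      \<exists>a. a - x \<in> sublattice L n \<and> (\<exists>b. b - y \<in> sublattice L n \<and> z = a + b)" for z
    by (rule exI[of _ "z - y"], auto simp: algebra_simps sublattice_0 intro!: exI[of _ y])
  moreover have "a - x \<in> sublattice L n \<Longrightarrow> b - y \<in> sublattice L n \<Longrightarrow>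
      a + b - (x + y) \<in> sublattice L n" for a b
    using sublattice_add[of "a - x" L n "b - y"] by (simp add: algebra_simps)
  ultimately show ?thesis
    by (auto simp: set_mult_def Zd_def odometer_kappa_eq)
qed

lemma quotient_proj_kappa: "quotient_proj L n (odometer_kappa L x (Suc n)) = odometer_kappa L x n"
proof -
  have "z - x \<in> sublattice L n \<Longrightarrow>
      \<exists>a. a - x \<in> sublattice L (Suc n) \<and> (\<exists>b \<in> sublattice L n. z = a + b)" for z
    by (rule exI[of _ x], auto simp: algebra_simps sublattice_0 intro!: bexI[of _ "z - x"])
  moreover have "a - x \<in> sublattice L (Suc n) \<Longrightarrow> b \<in> sublattice L n \<Longrightarrow>
      a + b - x \<in> sublattice L n" for a b
    using sublattice_add[of "a - x" L n b] sublattice_antimono[of n "Suc n" L]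
    by (auto simp: algebra_simps)
  ultimately show ?thesis
    by (auto simp: quotient_proj_def set_mult_def Zd_def odometer_kappa_eq)
qed

lemma carrier_lattice_quotient:
  "carrier (lattice_quotient L n) = range (\<lambda>x. odometer_kappa L x n)"
  by (simp add: lattice_quotient_def carrier_FactGroup odometer_kappa_def Zd_def)

text \<open>A coset in \<open>lattice_quotient L K\<close> determines all coarser ones, so any finite initial segment of
  a point of the odometer is that of some \<open>odometer_kappa L x\<close>. Such a representative \<open>x\<close> turns every
  computation below into one with vectors.\<close>

lemma carrier_odometer_group:
  "carrier (odometer_group L) = {g. \<forall>K. \<exists>x. \<forall>i\<le>K. g i = odometer_kappa L x i}"
proof (intro equalityI subsetI)
  fix g assume "g \<in> carrier (odometer_group L)"
  then have g: "\<And>n. g n \<in> range (\<lambda>x. odometer_kappa L x n)"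
    and p: "\<And>n. quotient_proj L n (g (Suc n)) = g n"
    by (auto simp: odometer_group_def carrier_lattice_quotient PiE_iff)
  have "\<exists>x. \<forall>i\<le>K. g i = odometer_kappa L x i" for K
  proof -
    obtain x where x: "g K = odometer_kappa L x K"
      using g by blast
    have "g i = odometer_kappa L x i" if "i \<le> K" for i
      using that x by (induction i rule: inc_induct) (metis p quotient_proj_kappa)+
    then show ?thesis by blast
  qed
  then show "g \<in> {g. \<forall>K. \<exists>x. \<forall>i\<le>K. g i = odometer_kappa L x i}"
    by blast
next
  fix g assume g: "g \<in> {g. \<forall>K. \<exists>x. \<forall>i\<le>K. g i = odometer_kappa L x i}"
  have "g n \<in> range (\<lambda>x. odometer_kappa L x n)" for n
    using g by blast
  moreover have "quotient_proj L n (g (Suc n)) = g n" for n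
  proof -
    obtain x where "\<forall>i\<le>Suc n. g i = odometer_kappa L x i"
      using g by blast
    then show ?thesis
      by (simp add: quotient_proj_kappa)
  qed
  ultimately show "g \<in> carrier (odometer_group L)"
    by (auto simp: odometer_group_def carrier_lattice_quotient)
qed

lemma topspace_odometer: "topspace (odometer_topology L) = carrier (odometer_group L)"
  by (auto simp: odometer_topology_def odometer_group_def)

lemma odometer_action_kappa:
  assumes "g i = odometer_kappa L x i"
  shows "odometer_action L k g i = odometer_kappa L (k + x) i"
  using assms by (simp add: odometer_action_def odometer_group_def lattice_quotient_def set_mult_kappa)

section \<open>Endomorphisms and nested lattices\<close>

text \<open>Continuity at the origin of the map that \<open>M\<close> induces on the lattice, for the topology in
  which the sublattices form a basis of neighbourhoods of the origin. This is the arithmetic content of being in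
  the linear representation group.\<close>

definition lattice_compatible :: "int ^ 'd ^ 'd \<Rightarrow> int ^ 'd ^ 'd \<Rightarrow> bool" where
  "lattice_compatible L M \<longleftrightarrow> (\<forall>n. \<exists>m. \<forall>x \<in> sublattice L m. M *v x \<in> sublattice L n)"

text \<open>An endomorphism \<open>\<phi>\<close> sends \<open>\<kappa>(k) = k + \<kappa>(0)\<close> to \<open>M k + \<phi>(\<kappa>(0))\<close>. By continuity at \<open>\<kappa>(0)\<close>, if \<open>k\<close>
  lies in a sufficiently fine sublattice, then \<open>\<phi>(\<kappa>(k))\<close> and \<open>\<phi>(\<kappa>(0))\<close> agree in coordinate \<open>n\<close>, that
  is, \<open>M k\<close> lies in \<open>sublattice L n\<close>.\<close>

lemma M_endomorphism_imp_lattice_compatible: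
  assumes "M_endomorphism (odometer_topology L) (odometer_action L) M \<phi>"
  shows "lattice_compatible L M"
  unfolding lattice_compatible_def
proof
  fix n
  let ?X = "odometer_topology L" and ?\<kappa> = "odometer_kappa L"
  have kappa: "?\<kappa> k \<in> topspace ?X" for k
    by (auto simp: topspace_odometer carrier_odometer_group)
  have cont: "continuous_map ?X ?X \<phi>"
    and equiv: "\<And>k g. g \<in> topspace ?X \<Longrightarrow> \<phi> (odometer_action L k g) = odometer_action L (M *v k) (\<phi> g)"
    using assms by (auto simp: M_endomorphism_def)
  have "\<phi> (?\<kappa> 0) \<in> topspace ?X"
    using cont kappa[of 0] by (auto simp: continuous_map_def)
  then obtain h where h: "\<phi> (?\<kappa> 0) n = ?\<kappa> h n"
    unfolding topspace_odometer carrier_odometer_group by blast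
  \<comment> \<open>The points whose image agrees with the image of the origin in coordinate \<open>n\<close> form a
    neighbourhood of the origin, and a basic open set constrains only coordinates up to some \<open>m\<close>.\<close>
  have "openin ?X {g \<in> topspace ?X. g n = ?\<kappa> h n}"
  proof -
    have *: "continuous_map ?X (discrete_topology (carrier (lattice_quotient L n))) (\<lambda>g. g n)"
      unfolding odometer_topology_def
      by (intro continuous_map_from_subtopology continuous_map_product_projection) auto
    show ?thesis
      using openin_continuous_map_preimage[OF *, of "{?\<kappa> h n}"]
      by (simp add: carrier_lattice_quotient)
  qed
  then have "openin ?X {g \<in> topspace ?X. \<phi> g \<in> {g \<in> topspace ?X. g n = ?\<kappa> h n}}"
    by (rule openin_continuous_map_preimage[OF cont])
  then obtain W where W: "openin (product_topology (\<lambda>n. discrete_topology (carrier (lattice_quotient L n))) UNIV) W"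
    and eq: "{g \<in> topspace ?X. \<phi> g \<in> {g \<in> topspace ?X. g n = ?\<kappa> h n}} = W \<inter> carrier (odometer_group L)"
    unfolding odometer_topology_def openin_subtopology by blast
  have "\<phi> (?\<kappa> 0) \<in> topspace ?X"
    using cont kappa by (auto simp: continuous_map_def)
  then have "?\<kappa> 0 \<in> W"
    using eq kappa[of 0] h by blast
  then obtain U where U: "finite {i. U i \<noteq> carrier (lattice_quotient L i)}"
    "?\<kappa> 0 \<in> Pi\<^sub>E UNIV U" "Pi\<^sub>E UNIV U \<subseteq> W"
    using W unfolding openin_product_topology_alt by auto
  then obtain m where m: "\<And>i. U i \<noteq> carrier (lattice_quotient L i) \<Longrightarrow> i \<le> m"
    unfolding finite_nat_set_iff_bounded_le by blast
  have "M *v k \<in> sublattice L n" if k: "k \<in> sublattice L m" for k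
  proof -
    have "?\<kappa> k i \<in> U i" for i
    proof (cases "i \<le> m")
      case True
      then have "?\<kappa> k i = ?\<kappa> 0 i"
        using k sublattice_antimono[of i m L] by (auto simp: odometer_kappa_eq_iff)
      then show ?thesis
        using U(2) by (simp add: PiE_iff)
    next
      case False
      then show ?thesis
        using m by (auto simp: carrier_lattice_quotient)
    qed
    then have "?\<kappa> k \<in> W"
      using U(3) by (auto simp: PiE_iff)
    then have "\<phi> (?\<kappa> k) n = ?\<kappa> h n"
      using eq kappa[of k] topspace_odometer by blast
    moreover have "?\<kappa> k = odometer_action L k (?\<kappa> 0)"
      by (rule ext, subst odometer_action_kappa[where x = 0]) simp_all
    then have "\<phi> (?\<kappa> k) n = ?\<kappa> (M *v k + h) n"
      using equiv[OF kappa[of 0]] odometer_action_kappa[of "\<phi> (?\<kappa> 0)", OF h] by simp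
    ultimately have "?\<kappa> (M *v k + h) n = ?\<kappa> h n"
      by simp
    then show ?thesis
      by (simp add: odometer_kappa_eq_iff)
  qed
  then show "\<exists>m. \<forall>x \<in> sublattice L m. M *v x \<in> sublattice L n"
    by blast
qed

text \<open>Conversely, if \<open>M\<close> maps \<open>sublattice L (m n)\<close> into \<open>sublattice L n\<close> for every \<open>n\<close>, then coordinate
  \<open>m n\<close> of a point determines coordinate \<open>n\<close> of its image. All terms of the union are then the same
  coset, so no representative has to be chosen.\<close>

definition induced_map ::
  "int ^ 'd ^ 'd \<Rightarrow> int ^ 'd ^ 'd \<Rightarrow> (nat \<Rightarrow> nat) \<Rightarrow> (nat \<Rightarrow> (int ^ 'd) set) \<Rightarrow> nat \<Rightarrow> (int ^ 'd) set" where
  "induced_map L M m g n = (\<Union>y \<in> g (m n). odometer_kappa L (M *v y) n)"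

lemma induced_map_kappa:
  assumes m: "\<And>n x. x \<in> sublattice L (m n) \<Longrightarrow> M *v x \<in> sublattice L n"
    and g: "g (m n) = odometer_kappa L x (m n)"
  shows "induced_map L M m g n = odometer_kappa L (M *v x) n"
proof -
  have "odometer_kappa L (M *v y) n = odometer_kappa L (M *v x) n" if "y \<in> g (m n)" for y
    using m[of "y - x" n] that
    by (simp add: g odometer_kappa_eq_iff odometer_kappa_eq[of L x] matrix_vector_mult_diff_distrib)
  moreover have "x \<in> g (m n)"
    by (simp add: g odometer_kappa_eq sublattice_0)
  ultimately show ?thesis
    unfolding induced_map_def by blast
qed

text \<open>One \<open>J\<close> serves all coordinates up to \<open>K\<close>, which keeps a single representative \<open>x\<close> valid
  throughout an initial segment.\<close>

lemma induced_map_prefix: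
  assumes m: "\<And>n x. x \<in> sublattice L (m n) \<Longrightarrow> M *v x \<in> sublattice L n"
  shows "\<exists>J. \<forall>g x. (\<forall>j\<le>J. g j = odometer_kappa L x j) \<longrightarrow>
           (\<forall>i\<le>K. induced_map L M m g i = odometer_kappa L (M *v x) i)"
proof -
  have "finite (m ` {..K})" by simp
  then obtain J where J: "\<forall>j \<in> m ` {..K}. j \<le> J"
    unfolding finite_nat_set_iff_bounded_le by blast
  show ?thesis
    by (rule exI[of _ J]) (use J in \<open>auto intro!: induced_map_kappa[OF m]\<close>)
qed

lemma induced_map_closed:
  assumes m: "\<And>n x. x \<in> sublattice L (m n) \<Longrightarrow> M *v x \<in> sublattice L n"
    and g: "g \<in> carrier (odometer_group L)"
  shows "induced_map L M m g \<in> carrier (odometer_group L)"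
  unfolding carrier_odometer_group
proof (intro CollectI allI)
  fix K
  obtain J where J: "\<forall>g x. (\<forall>j\<le>J. g j = odometer_kappa L x j) \<longrightarrow>
          (\<forall>i\<le>K. induced_map L M m g i = odometer_kappa L (M *v x) i)"
    using induced_map_prefix[of L m M K, OF m] by blast
  obtain x where "\<forall>j\<le>J. g j = odometer_kappa L x j"
    using g unfolding carrier_odometer_group by blast
  with J show "\<exists>x. \<forall>i\<le>K. induced_map L M m g i = odometer_kappa L x i"
    by blast
qed

lemma continuous_map_induced_map:
  assumes m: "\<And>n x. x \<in> sublattice L (m n) \<Longrightarrow> M *v x \<in> sublattice L n"
  shows "continuous_map (odometer_topology L) (odometer_topology L) (induced_map L M m)"
proof -
  let ?D = "\<lambda>n. discrete_topology (carrier (lattice_quotient L n))"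
  have "continuous_map (odometer_topology L) (?D n) (\<lambda>g. induced_map L M m g n)" for n
  proof -
    have "continuous_map (odometer_topology L) (?D (m n)) (\<lambda>g. g (m n))"
      unfolding odometer_topology_def
      by (intro continuous_map_from_subtopology continuous_map_product_projection) auto
    moreover have "continuous_map (?D (m n)) (?D n) (\<lambda>C. \<Union>y \<in> C. odometer_kappa L (M *v y) n)"
    proof -
      have "(\<Union>y \<in> C. odometer_kappa L (M *v y) n) \<in> carrier (lattice_quotient L n)"
        if C: "C \<in> carrier (lattice_quotient L (m n))" for C
      proof -
        obtain x where "C = odometer_kappa L x (m n)"
          using C unfolding carrier_lattice_quotient by blast
        then show ?thesis
          using induced_map_kappa[of L m M "\<lambda>_. C" n x, OF m]
          by (simp add: induced_map_def carrier_lattice_quotient)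
      qed
      then show ?thesis
        by (auto simp: continuous_map_def)
    qed
    ultimately have "continuous_map (odometer_topology L) (?D n)
        ((\<lambda>C. \<Union>y \<in> C. odometer_kappa L (M *v y) n) \<circ> (\<lambda>g. g (m n)))"
      by (rule continuous_map_compose)
    then show ?thesis
      by (simp add: induced_map_def comp_def)
  qed
  then have "continuous_map (odometer_topology L) (product_topology ?D UNIV) (induced_map L M m)"
    by (simp add: continuous_map_componentwise_UNIV)
  then show ?thesis
    using induced_map_closed[OF m]
    by (auto simp: odometer_topology_def continuous_map_in_subtopology topspace_odometer[unfolded odometer_topology_def])
qed

text \<open>The inverse matrix is used for surjectivity: its induced map is a right inverse.\<close>

lemma lattice_compatible_imp_M_endomorphism:
  assumes M: "lattice_compatible L M" and M': "lattice_compatible L M'" and inv: "M ** M' = mat 1"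
  shows "\<exists>\<phi>. M_endomorphism (odometer_topology L) (odometer_action L) M \<phi>"
proof -
  obtain m where m: "\<And>n x. x \<in> sublattice L (m n) \<Longrightarrow> M *v x \<in> sublattice L n"
    using M unfolding lattice_compatible_def by metis
  obtain m' where m': "\<And>n x. x \<in> sublattice L (m' n) \<Longrightarrow> M' *v x \<in> sublattice L n"
    using M' unfolding lattice_compatible_def by metis
  let ?\<phi> = "induced_map L M m" and ?\<psi> = "induced_map L M' m'"
  have right_inv: "?\<phi> (?\<psi> g) = g" if g: "g \<in> carrier (odometer_group L)" for g
  proof
    fix n
    obtain J where J: "\<forall>g x. (\<forall>j\<le>J. g j = odometer_kappa L x j) \<longrightarrow>
          (\<forall>i\<le>m n. ?\<psi> g i = odometer_kappa L (M' *v x) i)"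
      using induced_map_prefix[of L m' M' "m n", OF m'] by blast
    obtain x where x: "\<forall>j\<le>max J n. g j = odometer_kappa L x j"
      using g unfolding carrier_odometer_group by blast
    then have "?\<psi> g (m n) = odometer_kappa L (M' *v x) (m n)"
      using J by simp
    then have "?\<phi> (?\<psi> g) n = odometer_kappa L (M *v (M' *v x)) n"
      using induced_map_kappa[of L m M, OF m] by blast
    then show "?\<phi> (?\<psi> g) n = g n"
      using x by (simp add: matrix_vector_mul_assoc inv)
  qed
  have equiv: "?\<phi> (odometer_action L k g) = odometer_action L (M *v k) (?\<phi> g)"
    if g: "g \<in> carrier (odometer_group L)" for k g
  proof
    fix n
    obtain x where x: "g (m n) = odometer_kappa L x (m n)"
      using g unfolding carrier_odometer_group by blast
    have "?\<phi> (odometer_action L k g) n = odometer_kappa L (M *v (k + x)) n"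
      using x by (intro induced_map_kappa m odometer_action_kappa)
    also have "\<dots> = odometer_action L (M *v k) (?\<phi> g) n"
      unfolding matrix_vector_right_distrib
      using x by (intro odometer_action_kappa[symmetric] induced_map_kappa m)
    finally show "?\<phi> (odometer_action L k g) n = odometer_action L (M *v k) (?\<phi> g) n" .
  qed
  have "?\<phi> ` carrier (odometer_group L) = carrier (odometer_group L)"
  proof
    show "?\<phi> ` carrier (odometer_group L) \<subseteq> carrier (odometer_group L)"
      using induced_map_closed[OF m] by blast
    show "carrier (odometer_group L) \<subseteq> ?\<phi> ` carrier (odometer_group L)"
      using induced_map_closed[OF m'] right_inv by (metis image_eqI subsetI)
  qed
  then show ?thesis
    using continuous_map_induced_map[OF m] equiv
    unfolding M_endomorphism_def topspace_odometer by blast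
qed

section \<open>The linear representation group\<close>

lemma matrix_pow_Suc2: "matrix_pow A (Suc n) = matrix_pow A n ** A"
  using matrix_pow_add[of A n 1] by simp

lemma matrix_vector_mult_smult:
  fixes A :: "'a::comm_semiring_1 ^ 'n ^ 'm"
  shows "A *v (c *s x) = c *s (A *v x)"
  by (simp add: vec_eq_iff matrix_vector_mult_def sum_distrib_left mult.left_commute)

lemma matrix_vector_mult_uminus:
  fixes A :: "'a::comm_ring_1 ^ 'n ^ 'm"
  shows "A *v (- x) = - (A *v x)"
  using matrix_vector_mult_smult[of A "- 1" x] by (simp flip: vector_sneg_minus1)

lemma carrier_GL_int: "M \<in> carrier GL_int \<longleftrightarrow> invertible M"
  by (simp add: GL_int_def)

lemma mult_GL_int [simp]: "M \<otimes>\<^bsub>GL_int\<^esub> M' = M ** M'"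
  by (simp add: GL_int_def)

lemma one_GL_int [simp]: "\<one>\<^bsub>GL_int\<^esub> = mat 1"
  by (simp add: GL_int_def)

lemma group_GL_int: "group GL_int"
proof (rule groupI)
  fix A B :: "int ^ 'd ^ 'd"
  assume "A \<in> carrier GL_int" "B \<in> carrier GL_int"
  then show "A \<otimes>\<^bsub>GL_int\<^esub> B \<in> carrier GL_int"
    by (simp add: carrier_GL_int invertible_mult)
next
  show "\<one>\<^bsub>GL_int\<^esub> \<in> carrier (GL_int :: (int ^ 'd ^ 'd) monoid)"
    by (auto simp: carrier_GL_int invertible_def)
next
  fix A :: "int ^ 'd ^ 'd"
  assume "A \<in> carrier GL_int"
  then show "\<exists>B \<in> carrier GL_int. B \<otimes>\<^bsub>GL_int\<^esub> A = \<one>\<^bsub>GL_int\<^esub>"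
    by (simp add: carrier_GL_int invertible_def Bex_def) metis
qed (simp_all add: matrix_mul_assoc)

interpretation GL: group GL_int
  by (rule group_GL_int)

lemma lattice_compatible_mult:
  assumes "lattice_compatible L A" "lattice_compatible L B"
  shows "lattice_compatible L (A ** B)"
  unfolding lattice_compatible_def matrix_vector_mul_assoc[symmetric]
  using assms unfolding lattice_compatible_def by meson

lemma lattice_compatible_one: "lattice_compatible L (mat 1)"
  unfolding lattice_compatible_def by auto

lemma lattice_compatible_pow: "lattice_compatible L A \<Longrightarrow> lattice_compatible L (matrix_pow A k)"
  by (induction k) (simp_all add: lattice_compatible_one lattice_compatible_mult)

text \<open>Modulo \<open>q\<close> there are finitely many matrices. This serves twice: to find the inverse of a
  matrix among its powers modulo \<open>q\<close>, and to bound the index of a congruence subgroup.\<close>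

definition residue_matrix :: "int \<Rightarrow> int ^ 'd ^ 'd \<Rightarrow> int ^ 'd ^ 'd" where
  "residue_matrix q A = (\<chi> i j. A $ i $ j mod q)"

lemma finite_range_residue_matrix:
  assumes "q > 0"
  shows "finite (range (residue_matrix q :: int ^ 'd ^ 'd \<Rightarrow> int ^ 'd ^ 'd))"
proof (rule finite_subset)
  show "range (residue_matrix q) \<subseteq>
      (\<lambda>f. \<chi> i j. f (i, j)) ` (UNIV \<rightarrow>\<^sub>E {0..<q} :: ('d \<times> 'd \<Rightarrow> int) set)"
  proof (rule image_subsetI)
    fix A :: "int ^ 'd ^ 'd"
    show "residue_matrix q A \<in> (\<lambda>f. \<chi> i j. f (i, j)) ` (UNIV \<rightarrow>\<^sub>E {0..<q})"
      by (rule image_eqI[where x = "\<lambda>(i, j). A $ i $ j mod q"])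
        (use assms in \<open>auto simp: residue_matrix_def\<close>)
  qed
  show "finite ((\<lambda>f. \<chi> i j. f (i, j)) ` (UNIV \<rightarrow>\<^sub>E {0..<q} :: ('d \<times> 'd \<Rightarrow> int) set))"
    by (intro finite_imageI finite_PiE) auto
qed

lemma residue_matrix_eqD:
  assumes "residue_matrix q A = residue_matrix q B"
  shows "\<exists>R. \<forall>x. A *v x = B *v x + q *s (R *v x)"
proof -
  have "q dvd A $ i $ j - B $ i $ j" for i j
    using assms by (simp add: residue_matrix_def vec_eq_iff mod_eq_dvd_iff)
  then obtain R where R: "\<And>i j. A $ i $ j - B $ i $ j = q * R i j"
    unfolding dvd_def by metis
  have "A *v x = B *v x + q *s ((\<chi> i j. R i j) *v x)" for x
  proof -
    have "(A - B) *v x = q *s ((\<chi> i j. R i j) *v x)"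
      by (simp add: vec_eq_iff matrix_vector_mult_def R sum_distrib_left mult.assoc)
    then show ?thesis
      by (simp add: matrix_vector_mult_diff_rdistrib algebra_simps)
  qed
  then show ?thesis by blast
qed

text \<open>By the pigeonhole principle two powers of \<open>M\<close> agree modulo \<open>q\<close>, so \<open>M\<^sup>-\<^sup>1\<close> is congruent to a
  power \<open>M\<^sup>k\<close> modulo \<open>q\<close>. Since \<open>q\<close> annihilates the quotient by \<open>sublattice L n\<close>, the matrices
  \<open>M\<^sup>-\<^sup>1\<close> and \<open>M\<^sup>k\<close> act in the same way modulo that sublattice.\<close>

lemma lattice_compatible_inverse:
  assumes q: "\<And>n. \<exists>q. q \<noteq> 0 \<and> (\<forall>x. q *s x \<in> sublattice L n)"
    and M: "lattice_compatible L M" and inv: "M' ** M = mat 1"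
  shows "lattice_compatible L M'"
  unfolding lattice_compatible_def
proof
  fix n
  obtain q where q: "q \<noteq> 0" "\<And>x. q *s x \<in> sublattice L n"
    using q by blast
  have "finite (range (\<lambda>k. residue_matrix \<bar>q\<bar> (matrix_pow M k)))"
    by (rule finite_subset[OF _ finite_range_residue_matrix[of "\<bar>q\<bar>"]]) (use q(1) in auto)
  then have "\<not> inj (\<lambda>k. residue_matrix \<bar>q\<bar> (matrix_pow M k))"
    using finite_imageD infinite_UNIV_nat by blast
  then obtain i j where ij: "i < j"
    "residue_matrix \<bar>q\<bar> (matrix_pow M i) = residue_matrix \<bar>q\<bar> (matrix_pow M j)"
    unfolding inj_def by (metis linorder_neqE_nat)
  then obtain k where k: "j = i + Suc k"
    using less_imp_Suc_add by auto
  obtain R where R: "\<And>x. matrix_pow M i *v x = matrix_pow M j *v x + \<bar>q\<bar> *s (R *v x)"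
    using residue_matrix_eqD[OF ij(2)] by blast
  have cancel: "matrix_pow M' i ** matrix_pow M i = mat 1" for i
  proof (induction i)
    case (Suc i)
    have "matrix_pow M' (Suc i) ** matrix_pow M (Suc i)
        = matrix_pow M' i ** (M' ** M) ** matrix_pow M i"
      by (simp add: matrix_pow_Suc2[of M'] matrix_mul_assoc del: matrix_pow_Suc)
        (simp add: matrix_mul_assoc)
    then show ?case
      by (simp add: inv Suc)
  qed simp
  have M'_eq: "M' *v x = matrix_pow M k *v x + (\<bar>q\<bar> *s (M' *v (matrix_pow M' i *v (R *v x))))" for x
  proof -
    have "M' *v x = M' *v (matrix_pow M' i *v (matrix_pow M i *v x))"
      by (simp add: matrix_vector_mul_assoc cancel flip: matrix_mul_assoc)
    also have "\<dots> = M' *v (matrix_pow M' i *v (matrix_pow M j *v x)) +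
        \<bar>q\<bar> *s (M' *v (matrix_pow M' i *v (R *v x)))"
      by (simp add: R matrix_vector_right_distrib matrix_vector_mult_smult)
    also have "M' *v (matrix_pow M' i *v (matrix_pow M j *v x)) =
        (M' ** ((matrix_pow M' i ** matrix_pow M i) ** (M ** matrix_pow M k))) *v x"
      unfolding k matrix_pow_add matrix_pow_Suc by (simp add: matrix_vector_mul_assoc matrix_mul_assoc)
    also have "\<dots> = matrix_pow M k *v x"
      by (simp add: cancel matrix_mul_assoc inv)
    finally show ?thesis .
  qed
  obtain m where m: "\<And>x. x \<in> sublattice L m \<Longrightarrow> matrix_pow M k *v x \<in> sublattice L n"
    using lattice_compatible_pow[OF M, of k] unfolding lattice_compatible_def by blast
  have "\<bar>q\<bar> *s y \<in> sublattice L n" for y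
    using q(2)[of y] sublattice_minus[OF q(2)[of y]] vector_smult_lneg[of q y]
    by (cases "q \<ge> 0") auto
  then have "M' *v x \<in> sublattice L n" if "x \<in> sublattice L m" for x
    unfolding M'_eq[of x] using m[OF that] by (intro sublattice_add)
  then show "\<exists>m. \<forall>x \<in> sublattice L m. M' *v x \<in> sublattice L n"
    by blast
qed

lemma odometer_linear_rep_eq:
  assumes q: "\<And>n. \<exists>q. q \<noteq> 0 \<and> (\<forall>x. q *s x \<in> sublattice L n)"
  shows "odometer_linear_rep L = {M \<in> carrier GL_int. lattice_compatible L M}"
proof -
  have "\<exists>\<phi>. M_endomorphism (odometer_topology L) (odometer_action L) M \<phi>"
    if M: "M \<in> carrier GL_int" "lattice_compatible L M" for M
  proof -
    obtain M' where "M ** M' = mat 1" "M' ** M = mat 1"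
      using M(1) by (auto simp: carrier_GL_int invertible_def)
    then show ?thesis
      using lattice_compatible_imp_M_endomorphism[OF M(2) lattice_compatible_inverse[OF q M(2)]]
      by blast
  qed
  then show ?thesis
    using M_endomorphism_imp_lattice_compatible
    unfolding odometer_linear_rep_def linear_rep_def by blast
qed

lemma subgroup_odometer_linear_rep:
  assumes q: "\<And>n. \<exists>q. q \<noteq> 0 \<and> (\<forall>x. q *s x \<in> sublattice L n)"
  shows "subgroup (odometer_linear_rep L) GL_int"
proof (rule GL.subgroupI)
  show "odometer_linear_rep L \<noteq> {}"
    unfolding odometer_linear_rep_eq[OF q]
    using GL.one_closed lattice_compatible_one by fastforce
next
  fix M assume "M \<in> odometer_linear_rep L"
  then have M: "M \<in> carrier GL_int" "lattice_compatible L M"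
    unfolding odometer_linear_rep_eq[OF q] by auto
  show "inv\<^bsub>GL_int\<^esub> M \<in> odometer_linear_rep L"
    unfolding odometer_linear_rep_eq[OF q]
    using M lattice_compatible_inverse[OF q M(2), of "inv\<^bsub>GL_int\<^esub> M"] GL.l_inv[of M] by simp
next
  fix A B assume "A \<in> odometer_linear_rep L" "B \<in> odometer_linear_rep L"
  then show "A \<otimes>\<^bsub>GL_int\<^esub> B \<in> odometer_linear_rep L"
    unfolding odometer_linear_rep_eq[OF q]
    using GL.m_closed[of A B] by (simp add: lattice_compatible_mult)
qed (auto simp: odometer_linear_rep_eq[OF q])

section \<open>Integer matrices of size two\<close>

lemmas matrix_2_simps = matrix_matrix_mult_def matrix_vector_mult_def vec_eq_iff forall_2 sum_2
  det_2 trace_def mat_def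

text \<open>The matrix \<open>trace A - A\<close> is the adjugate of \<open>A\<close>.\<close>

lemma matrix_adjugate_2:
  fixes A :: "'a::comm_ring_1 ^ 2 ^ 2"
  shows "A *v ((mat (trace A) - A) *v x) = det A *s x"
  by (simp add: matrix_2_simps algebra_simps)

lemma det_pow_in_sublattice:
  fixes L :: "int ^ 2 ^ 2"
  shows "det L ^ n *s x \<in> sublattice L n"
proof -
  have "\<exists>y. det L ^ n *s x = matrix_pow L n *v y" for x
  proof (induction n arbitrary: x)
    case (Suc n)
    obtain y where y: "det L ^ n *s ((mat (trace L) - L) *v x) = matrix_pow L n *v y"
      using Suc by blast
    have "matrix_pow L (Suc n) *v y = L *v (matrix_pow L n *v y)"
      by (simp add: matrix_vector_mul_assoc)
    also have "\<dots> = det L ^ n *s (L *v ((mat (trace L) - L) *v x))"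
      by (simp add: matrix_vector_mult_smult flip: y)
    also have "\<dots> = det L ^ Suc n *s x"
      by (simp add: matrix_adjugate_2 mult.commute)
    finally show ?case by metis
  qed simp
  then show ?thesis
    unfolding sublattice_def by blast
qed

lemma matrix_adjugate_2':
  fixes A :: "'a::comm_ring_1 ^ 2 ^ 2"
  shows "(mat (trace A) - A) *v (A *v x) = det A *s x"
  by (simp add: matrix_2_simps algebra_simps)

text \<open>Over an integral domain, so that it applies both to complex eigenvectors and to integer ones.
  A singular nonzero matrix is annihilated by the columns of its adjugate.\<close>

lemma det_eq_0_iff_kernel_2:
  fixes A :: "'a::idom ^ 2 ^ 2"
  shows "det A = 0 \<longleftrightarrow> (\<exists>v. v \<noteq> 0 \<and> A *v v = 0)"
proof
  assume det: "det A = 0"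
  show "\<exists>v. v \<noteq> 0 \<and> A *v v = 0"
  proof (cases "A = 0")
    case True
    then show ?thesis
      by (intro exI[of _ "vector [1, 1]"]) (simp add: matrix_2_simps)
  next
    case False
    then obtain x where x: "(mat (trace A) - A) *v x \<noteq> 0"
    proof -
      assume *: "\<And>x. (mat (trace A) - A) *v x \<noteq> 0 \<Longrightarrow> thesis"
      have "(mat (trace A) - A) *v vector [1, 0] \<noteq> 0 \<or> (mat (trace A) - A) *v vector [0, 1] \<noteq> 0"
        using False by (auto simp: matrix_2_simps)
      then show thesis
        using * by blast
    qed
    then show ?thesis
      using matrix_adjugate_2[of A x] det by auto
  qed
next
  assume "\<exists>v. v \<noteq> 0 \<and> A *v v = 0"
  then obtain v where "v \<noteq> 0" "A *v v = 0" by blast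
  then have "det A *s v = 0"
    using matrix_adjugate_2'[of A v] by simp
  then show "det A = 0"
    using \<open>v \<noteq> 0\<close> by simp
qed

lemma is_eigenvalue_2_iff:
  fixes A :: "int ^ 2 ^ 2"
  shows "is_eigenvalue A z \<longleftrightarrow> z * z - of_int (trace A) * z + of_int (det A) = 0"
proof -
  let ?A = "map_matrix of_int A :: complex ^ 2 ^ 2"
  have "(?A *v v = z *s v) = ((?A - mat z) *v v = 0)" for v
    by (simp add: matrix_2_simps algebra_simps)
  then have "is_eigenvalue A z \<longleftrightarrow> det (?A - mat z) = 0"
    by (simp add: is_eigenvalue_def det_eq_0_iff_kernel_2)
  also have "det (?A - mat z) = z * z - of_int (trace A) * z + of_int (det A)"
    by (simp add: matrix_2_simps map_matrix_def algebra_simps)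
  finally show ?thesis .
qed

lemma is_eigenvalue_of_int_iff:
  fixes A :: "int ^ 2 ^ 2"
  shows "is_eigenvalue A (of_int l) \<longleftrightarrow> l * l - trace A * l + det A = 0"
  unfolding is_eigenvalue_2_iff by (simp flip: of_int_mult of_int_diff of_int_add)

lemma expansion_imp_det_nonzero:
  fixes A :: "int ^ 2 ^ 2"
  assumes "expansion A"
  shows "det A \<noteq> 0"
proof
  assume "det A = 0"
  then have "is_eigenvalue A 0"
    by (simp add: is_eigenvalue_2_iff)
  then show False
    using assms by (force simp: expansion_def)
qed

section \<open>Primitive vectors and the wedge product\<close>

text \<open>The determinant of the matrix with columns \<open>x\<close> and \<open>y\<close>. Two vectors of \<open>sublattice L n\<close> have a
  wedge divisible by \<open>det L ^ n\<close>; this is how membership in all the sublattices turns into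
  equations.\<close>

definition wedge :: "int ^ 2 \<Rightarrow> int ^ 2 \<Rightarrow> int" where
  "wedge x y = x $ 1 * y $ 2 - x $ 2 * y $ 1"

definition primitive :: "int ^ 2 \<Rightarrow> bool" where
  "primitive v \<longleftrightarrow> coprime (v $ 1) (v $ 2)"

lemma wedge_matrix: "wedge (A *v x) (A *v y) = det A * wedge x y"
  by (simp add: wedge_def matrix_2_simps algebra_simps)

lemma det_matrix_pow: "det (matrix_pow L n) = det L ^ n"
  by (induction n) (simp_all add: det_mul)

lemma det_pow_dvd_wedge:
  assumes "x \<in> sublattice L n" "y \<in> sublattice L n"
  shows "det L ^ n dvd wedge x y"
  using assms by (auto simp: sublattice_def wedge_matrix det_matrix_pow)

lemma primitive_nonzero: "primitive v \<Longrightarrow> v \<noteq> 0"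
  by (auto simp: primitive_def)

lemma primitive_Bezout:
  assumes "primitive v"
  obtains w where "wedge v w = 1"
proof -
  obtain a b where "a * v $ 1 + b * v $ 2 = 1"
    using assms bezout_int[of "v $ 1" "v $ 2"] unfolding primitive_def by auto
  then have "wedge v (vector [- b, a]) = 1"
    by (simp add: wedge_def algebra_simps)
  then show thesis ..
qed

text \<open>With \<open>wedge v w = 1\<close>, the vectors \<open>v\<close> and \<open>w\<close> form a basis of the lattice, and the wedges of
  \<open>x\<close> with them are its coordinates.\<close>

lemma wedge_eq_0_primitive:
  assumes "primitive v" "wedge v x = 0"
  shows "\<exists>k. x = k *s v"
proof -
  obtain w where w: "wedge v w = 1"
    using assms(1) by (rule primitive_Bezout)
  have "wedge v w *s x = wedge x w *s v + wedge v x *s w"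
    by (simp add: wedge_def vec_eq_iff forall_2 algebra_simps)
  then show ?thesis
    using w assms(2) by auto
qed

text \<open>Cramer's rule writes \<open>wedge x y *s z\<close> as a combination of \<open>x\<close> and \<open>y\<close>.\<close>

lemma wedge_independent:
  fixes A :: "int ^ 2 ^ 2"
  assumes "A *v x = 0" "A *v y = 0" "wedge x y \<noteq> 0"
  shows "A = 0"
proof -
  have "wedge x y *s (A *v z) = 0" for z
  proof -
    have "wedge x y *s (A *v z) = wedge z y *s (A *v x) + wedge x z *s (A *v y)"
      by (simp add: wedge_def matrix_2_simps algebra_simps)
    then show ?thesis
      using assms by simp
  qed
  then have "A *v z = 0" for z
    using assms(3) by (simp add: vec_eq_iff)
  then show ?thesis
    by (simp add: matrix_eq)
qed

lemma primitive_kernel: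
  assumes "det (A :: int ^ 2 ^ 2) = 0"
  shows "\<exists>v. primitive v \<and> A *v v = 0"
proof -
  obtain v where v: "v \<noteq> 0" "A *v v = 0"
    using assms det_eq_0_iff_kernel_2 by blast
  obtain g a b where g: "g \<noteq> 0" and ab: "v $ 1 = a * g" "v $ 2 = b * g" "coprime a b"
  proof -
    have "gcd (v $ 1) (v $ 2) \<noteq> 0"
      using v(1) by (simp add: vec_eq_iff forall_2)
    then show thesis
      using gcd_coprime_exists[of "v $ 1" "v $ 2"] that by blast
  qed
  then have "v = g *s vector [a, b]"
    by (simp add: vec_eq_iff forall_2)
  then have "g *s (A *v vector [a, b]) = 0"
    using v(2) by (metis matrix_vector_mult_smult)
  then have "A *v vector [a, b] = 0"
    using g by (simp add: vec_eq_iff)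
  moreover have "primitive (vector [a, b])"
    using ab(3) by (simp add: primitive_def)
  ultimately show ?thesis by blast
qed

section \<open>The case where the radical of the determinant divides the trace\<close>

lemma dvd_power_if_prime_divisors:
  fixes d r :: int
  assumes "d \<noteq> 0" "\<And>p. prime p \<Longrightarrow> p dvd d \<Longrightarrow> p dvd r"
  shows "\<exists>e. d dvd r ^ e"
  using assms
proof (induction d rule: prime_divisors_induct)
  case (unit x)
  then show ?case
    by (meson unit_imp_dvd)
next
  case (factor p x)
  then obtain e where "x dvd r ^ e"
    by auto
  moreover have "p dvd r"
    using factor.hyps factor.prems(2)[of p] by simp
  ultimately have "p * x dvd r ^ Suc e"
    by (simp add: mult_dvd_mono)
  then show ?case ..
qed simp

lemma prime_dvd_rad: "n \<noteq> 0 \<Longrightarrow> prime p \<Longrightarrow> p dvd n \<Longrightarrow> p dvd rad n"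
  unfolding rad_def by (rule dvd_prodI) (auto simp: prime_factors_dvd)

lemma rad_dvdI:
  assumes "\<And>p. prime p \<Longrightarrow> p dvd n \<Longrightarrow> p dvd t"
  shows "rad n dvd t"
proof -
  have "\<Prod>P dvd t" if "finite P" "P \<subseteq> prime_factors n" for P
    using that
  proof (induction P rule: finite_induct)
    case (insert p P)
    have p: "prime p" "p dvd t"
      using insert.prems assms by auto
    have "coprime p (\<Prod>P)"
    proof (rule prod_coprime_right)
      fix q assume "q \<in> P"
      then show "coprime p q"
        using insert.hyps insert.prems by (intro primes_coprime) auto
    qed
    then show ?case
      using insert p by (simp add: divides_mult)
  qed simp
  then show ?thesis
    unfolding rad_def by simp
qed

text \<open>Write \<open>r = rad (det L)\<close>. By Cayley-Hamilton \<open>L\<^sup>2 = trace L * L - det L\<close>, which is divisible by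
  \<open>r\<close>. So high powers of \<open>L\<close> are divisible by high powers of \<open>r\<close>, hence by \<open>det L ^ n\<close>: every deep
  sublattice lies in \<open>det L ^ n\<close> times the full lattice, which any integer matrix preserves.\<close>

lemma lattice_compatible_if_rad_dvd_trace:
  fixes L M :: "int ^ 2 ^ 2"
  assumes "det L \<noteq> 0" "rad (det L) dvd trace L"
  shows "lattice_compatible L M"
  unfolding lattice_compatible_def
proof
  fix n
  define r where "r = rad (det L)"
  obtain e where e: "det L dvd r ^ e"
    using dvd_power_if_prime_divisors[of "det L" r] prime_dvd_rad assms(1) unfolding r_def by blast
  obtain c where c: "r ^ (e * n) = det L ^ n * c"
    using dvd_power_same[OF e, of n] by (auto simp: power_mult)
  have "r dvd det L"
    unfolding r_def by (rule rad_dvdI)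
  then obtain t d where td: "trace L = r * t" "det L = r * d"
    using assms(2) unfolding r_def by (metis dvdE)
  have square: "\<exists>y. L *v (L *v x) = r *s y" for x
  proof
    have "L *v (L *v x) = trace L *s (L *v x) - det L *s x"
      by (simp add: matrix_2_simps algebra_simps)
    then show "L *v (L *v x) = r *s (t *s (L *v x) - d *s x)"
      by (simp add: td vec_eq_iff right_diff_distrib)
  qed
  have power: "\<exists>y. matrix_pow L (2 * k) *v x = r ^ k *s y" for k x
  proof (induction k)
    case (Suc k)
    then obtain y where y: "matrix_pow L (2 * k) *v x = r ^ k *s y" ..
    obtain z where z: "L *v (L *v y) = r *s z"
      using square ..
    have "matrix_pow L (2 * Suc k) *v x = L *v (L *v (r ^ k *s y))"
      by (simp flip: y add: matrix_vector_mul_assoc matrix_mul_assoc)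
    also have "\<dots> = r ^ Suc k *s z"
      by (simp add: matrix_vector_mult_smult z mult.commute)
    finally show ?case ..
  qed simp
  have "M *v x \<in> sublattice L n" if x: "x \<in> sublattice L (2 * (e * n))" for x
  proof -
    obtain y where "x = r ^ (e * n) *s y"
      using x power unfolding sublattice_def by force
    then have "M *v x = det L ^ n *s (c *s (M *v y))"
      by (simp add: c matrix_vector_mult_smult)
    then show ?thesis
      using det_pow_in_sublattice[of L n "c *s (M *v y)"] by simp
  qed
  then show "\<exists>m. \<forall>x \<in> sublattice L m. M *v x \<in> sublattice L n"
    by blast
qed

section \<open>Commutation in the absence of integer eigenvalues\<close>

text \<open>The hypotheses say that \<open>w\<close> is an eigenvector of both \<open>L\<close> and \<open>M\<close> modulo \<open>q\<close>. Therefore the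
  commutator kills \<open>w\<close> modulo \<open>q\<close>, and as one coordinate of \<open>w\<close> is a unit modulo \<open>q\<close>, its
  determinant vanishes there.\<close>

lemma dvd_det_commutator:
  fixes L M :: "int ^ 2 ^ 2"
  assumes L: "q dvd wedge w (L *v w)" and M: "q dvd wedge w (M *v w)" and w: "coprime q (w $ i)"
  shows "q dvd det (L ** M - M ** L)"
proof -
  define C where "C = L ** M - M ** L"
  define x where "x = w $ 1"
  define y where "y = w $ 2"
  define e where "e = L $ 2 $ 2 - L $ 1 $ 1"
  define e' where "e' = M $ 2 $ 2 - M $ 1 $ 1"
  define f where "f = wedge w (L *v w)"
  define g where "g = wedge w (M *v w)"
  \<comment> \<open>Identities 1 to 3 express products of the coordinates of \<open>w\<close> and of \<open>C *v w\<close> through the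
    quadratic forms \<open>f\<close> and \<open>g\<close>, after eliminating one coefficient of each. Identities 4 and 5 are
    the adjugate of \<open>C\<close> applied to \<open>C *v w\<close>.\<close>
  have 1: "y * (C *v w) $ 2 = M $ 2 $ 1 * f - L $ 2 $ 1 * g"
    and 2: "x * (C *v w) $ 1 = L $ 1 $ 2 * g - M $ 1 $ 2 * f"
    and 3: "x * (C *v w) $ 2 + y * (C *v w) $ 1 = e * g - e' * f"
    by (simp_all add: C_def x_def y_def e_def e'_def f_def g_def wedge_def matrix_2_simps algebra_simps)
  have 4: "det C * x = C $ 2 $ 2 * (C *v w) $ 1 - C $ 1 $ 2 * (C *v w) $ 2"
    and 5: "det C * y = C $ 1 $ 1 * (C *v w) $ 2 - C $ 2 $ 1 * (C *v w) $ 1"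
    by (simp_all add: x_def y_def matrix_2_simps algebra_simps)
  have d1: "q dvd y * (C *v w) $ 2" and d2: "q dvd x * (C *v w) $ 1"
    and d3: "q dvd x * (C *v w) $ 2 + y * (C *v w) $ 1"
    unfolding 1 2 3 using L M by (auto simp: f_def g_def)
  have "q dvd det C"
  proof (cases "i = 1")
    case True
    then have cop: "coprime q x"
      using w by (simp add: x_def)
    then have a: "q dvd (C *v w) $ 1"
      using d2 coprime_dvd_mult_right_iff by blast
    then have "q dvd x * (C *v w) $ 2"
      using d3 dvd_add_left_iff dvd_mult by blast
    then have "q dvd (C *v w) $ 2"
      using cop coprime_dvd_mult_right_iff by blast
    then have "q dvd det C * x"
      unfolding 4 using a by auto
    then show ?thesis
      using cop coprime_dvd_mult_left_iff by blast
  next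
    case False
    then have cop: "coprime q y"
      using w exhaust_2[of i] by (auto simp: y_def)
    then have a: "q dvd (C *v w) $ 2"
      using d1 coprime_dvd_mult_right_iff by blast
    then have "q dvd y * (C *v w) $ 1"
      using d3 dvd_add_right_iff dvd_mult by blast
    then have "q dvd (C *v w) $ 1"
      using cop coprime_dvd_mult_right_iff by blast
    then have "q dvd det C * y"
      unfolding 5 using a by auto
    then show ?thesis
      using cop coprime_dvd_mult_left_iff by blast
  qed
  then show ?thesis
    by (simp add: C_def)
qed

lemma eq_0_if_all_prime_powers_dvd:
  fixes p a :: int
  assumes "prime p" "\<And>n. p ^ n dvd a"
  shows "a = 0"
proof (rule ccontr)
  assume "a \<noteq> 0"
  then have "finite {n. p ^ n dvd a}"
    using assms(1) by (intro finite_divisor_powers) (auto dest: not_prime_unit)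
  then show False
    using assms(2) by simp
qed

text \<open>Modulo a prime divisor of the determinant, Cayley-Hamilton reads \<open>L\<^sup>2 = trace L * L\<close>.\<close>

lemma matrix_pow_mod_prime:
  fixes L :: "int ^ 2 ^ 2"
  assumes "p dvd det L"
  shows "\<exists>y. matrix_pow L (Suc k) *v x = trace L ^ k *s (L *v x) + p *s y"
proof (induction k)
  case (Suc k)
  then obtain y where y: "matrix_pow L (Suc k) *v x = trace L ^ k *s (L *v x) + p *s y" ..
  obtain d where d: "det L = p * d"
    using assms ..
  have "matrix_pow L (Suc (Suc k)) *v x = L *v (trace L ^ k *s (L *v x) + p *s y)"
    unfolding y[symmetric] by (simp add: matrix_vector_mul_assoc)
  also have "\<dots> = trace L ^ k *s (L *v (L *v x)) + p *s (L *v y)"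
    by (simp add: matrix_vector_right_distrib matrix_vector_mult_smult)
  also have "L *v (L *v x) = trace L *s (L *v x) - det L *s x"
    by (simp add: matrix_2_simps algebra_simps)
  also have "trace L ^ k *s (trace L *s (L *v x) - det L *s x) + p *s (L *v y)
      = trace L ^ Suc k *s (L *v x) + p *s (L *v y - (trace L ^ k * d) *s x)"
    by (simp add: vec_eq_iff d algebra_simps)
  finally show ?case ..
qed (auto intro: exI[of _ 0])

text \<open>If \<open>p\<close> divides \<open>det L\<close> but not \<open>trace L\<close>, then over the \<open>p\<close>-adic integers \<open>L\<close> has exactly one
  eigenline with a unit eigenvalue; it is the intersection of the images of the powers of \<open>L\<close>, so \<open>M\<close> preserves it
  and the commutator kills it. The proof replaces that line by its approximations
  \<open>w = matrix_pow L k *v axis i 1\<close>, which by \<open>matrix_pow_mod_prime\<close> do not vanish modulo \<open>p\<close>: the vectors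
  \<open>w\<close>, \<open>L *v w\<close> and \<open>M *v w\<close> all lie in \<open>sublattice L n\<close>, so their wedges vanish modulo \<open>p ^ n\<close>.\<close>

lemma det_commutator_eq_0:
  fixes L M :: "int ^ 2 ^ 2"
  assumes p: "prime p" "p dvd det L" "\<not> p dvd trace L"
    and M: "lattice_compatible L M"
  shows "det (L ** M - M ** L) = 0"
proof (rule eq_0_if_all_prime_powers_dvd[OF p(1)])
  fix n
  obtain m where m: "\<And>x. x \<in> sublattice L m \<Longrightarrow> M *v x \<in> sublattice L n"
    using M unfolding lattice_compatible_def by blast
  obtain i where i: "\<not> p dvd L $ i $ i"
    using p(3) dvd_add[of p "L $ 1 $ 1" "L $ 2 $ 2"] by (auto simp: trace_def sum_2)
  define w where "w = matrix_pow L (Suc (m + n)) *v axis i 1"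
  obtain y where "w = trace L ^ (m + n) *s (L *v axis i 1) + p *s y"
    using matrix_pow_mod_prime[OF p(2)] unfolding w_def by blast
  moreover have "(L *v axis i 1) $ i = L $ i $ i"
    using exhaust_2[of i] by (auto simp: matrix_vector_mult_def sum_2 axis_def)
  ultimately have "w $ i = trace L ^ (m + n) * L $ i $ i + p * y $ i"
    by simp
  then have "\<not> p dvd w $ i"
    using i p(1,3) by (simp add: dvd_add_left_iff prime_dvd_mult_iff prime_dvd_power_iff)
      (metis p(1,3) prime_dvd_power)
  then have cop: "coprime (p ^ n) (w $ i)"
    using p(1) by (simp add: prime_imp_coprime)
  have w: "w \<in> sublattice L (Suc (m + n))" and Lw: "L *v w \<in> sublattice L (Suc (Suc (m + n)))"
    by (auto simp: w_def sublattice_def matrix_vector_mul_assoc)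
  have "w \<in> sublattice L n" "w \<in> sublattice L m" "L *v w \<in> sublattice L n"
    using w Lw sublattice_antimono[of n "Suc (m + n)" L] sublattice_antimono[of m "Suc (m + n)" L]
      sublattice_antimono[of n "Suc (Suc (m + n))" L] by auto
  then have "det L ^ n dvd wedge w (L *v w)" "det L ^ n dvd wedge w (M *v w)"
    using m by (auto intro: det_pow_dvd_wedge)
  then have "p ^ n dvd wedge w (L *v w)" "p ^ n dvd wedge w (M *v w)"
    using dvd_power_same[OF p(2)] dvd_trans by blast+
  then show "p ^ n dvd det (L ** M - M ** L)"
    using cop by (rule dvd_det_commutator)
qed

text \<open>The commutator \<open>C\<close> has trace zero and satisfies \<open>C L + L C = trace L * C\<close>. So \<open>L\<close> maps its kernel
  into itself; if \<open>C\<close> is singular and nonzero, this kernel is spanned by a primitive vector, whose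
  eigenvalue under \<open>L\<close> is an integer.\<close>

lemma commute_if_no_integer_eigenvalue:
  fixes L M :: "int ^ 2 ^ 2"
  assumes eig: "\<not> (\<exists>z. is_eigenvalue L z \<and> z \<in> \<int>)"
    and det: "det (L ** M - M ** L) = 0"
  shows "M ** L = L ** M"
proof -
  define C where "C = L ** M - M ** L"
  obtain v where v: "primitive v" "C *v v = 0"
    using primitive_kernel[OF det] unfolding C_def by blast
  have "wedge v (L *v v) \<noteq> 0"
  proof
    assume "wedge v (L *v v) = 0"
    then obtain k where k: "L *v v = k *s v"
      using wedge_eq_0_primitive[OF v(1)] by blast
    have "(L - mat k) *v v = L *v v - k *s v"
      by (simp add: matrix_2_simps algebra_simps)
    then have "det (L - mat k) = 0"
      using k primitive_nonzero[OF v(1)] det_eq_0_iff_kernel_2 by auto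
    then have "is_eigenvalue L (of_int k)"
      by (simp add: is_eigenvalue_of_int_iff matrix_2_simps algebra_simps)
    then show False
      using eig Ints_of_int by blast
  qed
  moreover have "C *v (L *v v) = trace L *s (C *v v) - L *v (C *v v)"
    by (simp add: C_def matrix_2_simps algebra_simps)
  ultimately have "C = 0"
    using v(2) wedge_independent by simp
  then show ?thesis
    by (simp add: C_def)
qed

lemma commute_matrix_pow: "M ** L = L ** M \<Longrightarrow> M ** matrix_pow L n = matrix_pow L n ** M"
  by (induction n) (simp_all add: matrix_mul_assoc, simp flip: matrix_mul_assoc)

lemma lattice_compatible_if_commute:
  assumes "M ** L = L ** M"
  shows "lattice_compatible L M"
proof -
  have "M *v (matrix_pow L n *v y) = matrix_pow L n *v (M *v y)" for n y
    by (simp add: matrix_vector_mul_assoc commute_matrix_pow[OF assms])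
  then have "M *v x \<in> sublattice L n" if "x \<in> sublattice L n" for x n
    using that unfolding sublattice_def by auto
  then show ?thesis
    unfolding lattice_compatible_def by blast
qed

lemma invertible_imp_det_unit:
  fixes M :: "int ^ 'd ^ 'd"
  assumes "invertible M"
  shows "\<bar>det M\<bar> = 1"
proof -
  obtain M' where "M ** M' = mat 1"
    using assms by (auto simp: invertible_def)
  then have "det M * det M' = 1"
    by (metis det_I det_mul)
  then show ?thesis
    using zmult_eq_1_iff by fastforce
qed

text \<open>A matrix \<open>M\<close> commuting with \<open>L\<close> is determined by its trace and one off-diagonal entry. In these two
  parameters the condition \<open>det M = \<plusminus>1\<close> is a quadratic equation whose form is definite, because the
  discriminant \<open>D\<close> of \<open>L\<close> is negative; so it has finitely many solutions.\<close>

lemma finite_Cent_GL: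
  fixes L :: "int ^ 2 ^ 2"
  assumes "\<not> (\<exists>z. is_eigenvalue L z \<and> z \<in> \<real>)"
  shows "finite (Cent_GL L)"
proof -
  define D where "D = trace L ^ 2 - 4 * det L"
  have D: "D < 0"
  proof (rule ccontr)
    assume "\<not> D < 0"
    define z where "z = (real_of_int (trace L) + sqrt (real_of_int D)) / 2"
    have "sqrt (real_of_int D) * sqrt (real_of_int D) = real_of_int D"
      using \<open>\<not> D < 0\<close> by simp
    then have "z * z - real_of_int (trace L) * z + real_of_int (det L) = 0"
      by (simp add: z_def D_def field_simps power2_eq_square)
    then have "complex_of_real (z * z - real_of_int (trace L) * z + real_of_int (det L)) = 0"
      by (simp only: of_real_0)
    then have "is_eigenvalue L (complex_of_real z)"
      by (simp add: is_eigenvalue_2_iff)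
    then show False
      using assms Reals_of_real by blast
  qed
  define q where "q = L $ 1 $ 2"
  have q: "q \<noteq> 0"
  proof
    assume "q = 0"
    then have "D = (L $ 1 $ 1 - L $ 2 $ 2) ^ 2"
      by (simp add: D_def q_def matrix_2_simps power2_eq_square algebra_simps)
    then show False
      using D by simp
  qed
  let ?h = "\<lambda>M :: int ^ 2 ^ 2. (trace M, M $ 1 $ 2)"
  have comm: "M $ 1 $ 2 * L $ 2 $ 1 = M $ 2 $ 1 * q"
      "(M $ 1 $ 1 - M $ 2 $ 2) * q = M $ 1 $ 2 * (L $ 1 $ 1 - L $ 2 $ 2)" if M: "M \<in> Cent_GL L" for M
  proof -
    have eq: "(M ** L) $ i $ j = (L ** M) $ i $ j" for i j
      using M by (simp add: Cent_GL_def)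
    show "M $ 1 $ 2 * L $ 2 $ 1 = M $ 2 $ 1 * q"
      using eq[of 1 1] by (simp add: q_def matrix_matrix_mult_def sum_2 mult.commute)
    show "(M $ 1 $ 1 - M $ 2 $ 2) * q = M $ 1 $ 2 * (L $ 1 $ 1 - L $ 2 $ 2)"
      using eq[of 1 2] by (simp add: q_def matrix_matrix_mult_def sum_2 algebra_simps)
  qed
  have "inj_on ?h (Cent_GL L)"
  proof (rule inj_onI)
    fix M N assume MN: "M \<in> Cent_GL L" "N \<in> Cent_GL L" "?h M = ?h N"
    have "M $ 2 $ 1 * q = N $ 2 $ 1 * q"
      "(M $ 1 $ 1 - M $ 2 $ 2) * q = (N $ 1 $ 1 - N $ 2 $ 2) * q"
      using comm[OF MN(1)] comm[OF MN(2)] MN(3) by auto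
    then show "M = N"
      using q MN(3) by (auto simp: matrix_2_simps)
  qed
  moreover have "?h ` Cent_GL L \<subseteq> {-2..2} \<times> {-2 * \<bar>q\<bar>..2 * \<bar>q\<bar>}"
  proof (rule image_subsetI)
    fix M assume M: "M \<in> Cent_GL L"
    have "q ^ 2 * (4 * det M) = (q * trace M) ^ 2 - ((M $ 1 $ 1 - M $ 2 $ 2) * q) ^ 2
        - 4 * (M $ 1 $ 2 * q) * (M $ 2 $ 1 * q)"
      by (simp add: matrix_2_simps power2_eq_square algebra_simps)
    also have "\<dots> = (q * trace M) ^ 2 - D * (M $ 1 $ 2) ^ 2"
      unfolding comm[OF M, symmetric] unfolding comm(2)[OF M]
      by (simp add: D_def q_def matrix_2_simps power2_eq_square algebra_simps)
    finally have *: "(q * trace M) ^ 2 + (- D) * (M $ 1 $ 2) ^ 2 = q ^ 2 * (4 * det M)"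
      by simp
    have "\<bar>det M\<bar> = 1"
      using M invertible_imp_det_unit by (auto simp: Cent_GL_def carrier_GL_int)
    then have "q ^ 2 * (4 * det M) \<le> q ^ 2 * 4"
      by (intro mult_left_mono) auto
    then have sum: "(q * trace M) ^ 2 + (- D) * (M $ 1 $ 2) ^ 2 \<le> q ^ 2 * 4"
      using * by simp
    have "0 \<le> (- D) * (M $ 1 $ 2) ^ 2" "1 * (M $ 1 $ 2) ^ 2 \<le> (- D) * (M $ 1 $ 2) ^ 2"
      using D by (intro mult_nonneg_nonneg mult_right_mono; simp)+
    then have "(q * trace M) ^ 2 \<le> q ^ 2 * 4" "(M $ 1 $ 2) ^ 2 \<le> q ^ 2 * 4"
      using sum zero_le_power2[of "q * trace M"] by linarith+
    then have "(q * trace M) ^ 2 \<le> (2 * q) ^ 2" "(M $ 1 $ 2) ^ 2 \<le> (2 * q) ^ 2"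
      by (simp_all add: power_mult_distrib)
    then have "\<bar>q * trace M\<bar> \<le> \<bar>2 * q\<bar>" "\<bar>M $ 1 $ 2\<bar> \<le> \<bar>2 * q\<bar>"
      by (simp_all only: abs_le_square_iff)
    then have "\<bar>trace M\<bar> \<le> 2" "\<bar>M $ 1 $ 2\<bar> \<le> \<bar>2 * q\<bar>"
      using q by (simp_all add: abs_mult mult.commute)
    then show "?h M \<in> {-2..2} \<times> {-2 * \<bar>q\<bar>..2 * \<bar>q\<bar>}"
      by (auto simp: abs_mult)
  qed
  ultimately show ?thesis
    by (meson finite_SigmaI finite_atLeastAtMost_int finite_imageD finite_subset)
qed

section \<open>Preservation of integer eigenvectors\<close>

definition line_stabilizer :: "int ^ 2 \<Rightarrow> (int ^ 2 ^ 2) set" where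
  "line_stabilizer v = {M \<in> carrier GL_int. M *v v = v \<or> M *v v = - v}"

lemma invertible_eigenvector_primitive:
  assumes v: "primitive v" and M: "invertible M" and eq: "wedge v (M *v v) = 0"
  shows "M *v v = v \<or> M *v v = - v"
proof -
  obtain k where k: "M *v v = k *s v"
    using wedge_eq_0_primitive[OF v eq] by blast
  obtain M' where "M' ** M = mat 1"
    using M by (auto simp: invertible_def)
  then have "v = M' *v (M *v v)"
    by (simp add: matrix_vector_mul_assoc)
  then have "v = k *s (M' *v v)"
    by (simp add: k matrix_vector_mult_smult)
  then have "v $ i = k * (M' *v v) $ i" for i
    by (metis vector_smult_component)
  then have "k dvd v $ i" for i
    by (metis dvd_triv_left)
  then have "is_unit k"
    using v unfolding primitive_def by (meson coprime_common_divisor)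
  then have "k = 1 \<or> k = - 1"
    by auto
  then show ?thesis
    using k by (auto simp: vec_eq_iff)
qed

lemma matrix_pow_eigenvector: "L *v v = l *s v \<Longrightarrow> matrix_pow L n *v v = l ^ n *s (v :: int ^ 'd)"
  by (induction n)
    (simp_all add: matrix_vector_mult_smult mult.commute flip: matrix_vector_mul_assoc)

text \<open>The rational counterpart of \<open>det_commutator_eq_0\<close>: here the \<open>p\<close>-adic unit eigenline is spanned by
  the integer vector \<open>v\<close>. Both \<open>l ^ n *s v\<close> and \<open>M *v (l ^ m *s v)\<close> lie in \<open>sublattice L n\<close>, and \<open>l\<close> is
  prime to \<open>p\<close>.\<close>

lemma eigenvector_preserved:
  fixes L M :: "int ^ 2 ^ 2"
  assumes v: "L *v v = l *s v"
    and p: "prime p" "p dvd det L" "\<not> p dvd l"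
    and M: "lattice_compatible L M"
  shows "wedge v (M *v v) = 0"
proof (rule eq_0_if_all_prime_powers_dvd[OF p(1)])
  fix n
  obtain m where m: "\<And>x. x \<in> sublattice L m \<Longrightarrow> M *v x \<in> sublattice L n"
    using M unfolding lattice_compatible_def by blast
  have pow: "l ^ k *s v \<in> sublattice L k" for k
    unfolding sublattice_def using matrix_pow_eigenvector[OF v, of k] by (metis rangeI)
  have "det L ^ n dvd wedge (l ^ n *s v) (M *v (l ^ m *s v))"
    by (intro det_pow_dvd_wedge m pow)
  also have "wedge (l ^ n *s v) (M *v (l ^ m *s v)) = l ^ (n + m) * wedge v (M *v v)"
    by (simp add: matrix_vector_mult_smult wedge_def power_add algebra_simps)
  finally have "p ^ n dvd l ^ (n + m) * wedge v (M *v v)"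
    using dvd_power_same[OF p(2)] dvd_trans by blast
  moreover have "coprime (p ^ n) (l ^ (n + m))"
    using p(1,3) by (simp add: prime_imp_coprime)
  ultimately show "p ^ n dvd wedge v (M *v v)"
    using coprime_dvd_mult_right_iff by blast
qed

lemma wedge_self [simp]: "wedge v v = 0"
  by (simp add: wedge_def)

lemma wedge_add [simp]: "wedge v (x + y) = wedge v x + wedge v y"
  by (simp add: wedge_def algebra_simps)

lemma wedge_diff: "wedge v (x - y) = wedge v x - wedge v y"
  by (simp add: wedge_def algebra_simps)

lemma wedge_smult [simp]: "wedge v (c *s x) = c * wedge v x" "wedge (c *s v) x = c * wedge v x"
  by (simp_all add: wedge_def algebra_simps)

text \<open>Since \<open>M\<close> acts on the line of \<open>v\<close> and on the quotient by it as a scalar, the commutator \<open>C\<close> kills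
  \<open>v\<close> and has values on that line, where \<open>L\<close> acts as \<open>l\<close>; on the quotient \<open>L\<close> acts as \<open>l'\<close>.\<close>

lemma commutator_eigenvector:
  fixes L M :: "int ^ 2 ^ 2"
  assumes v: "primitive v" "L *v v = l *s v" and l: "l \<noteq> 0" "det L = l * l'"
    and M: "M *v v = e *s v" "e \<noteq> 0"
  defines "C \<equiv> M ** L - L ** M"
  shows "L *v (C *v x) = l *s (C *v x)" and "C *v (L *v x) = l' *s (C *v x)"
proof -
  have C: "C *v x = M *v (L *v x) - L *v (M *v x)" for x
    by (simp add: C_def matrix_vector_mult_diff_rdistrib matrix_vector_mul_assoc)
  have wedge_L: "wedge v (L *v x) = l' * wedge v x" for x
    using wedge_matrix[of L v x] l by (simp add: v(2) wedge_smult)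
  have "e * wedge v (C *v x) = wedge (M *v v) (M *v (L *v x)) - l' * wedge (M *v v) (M *v x)"
    by (simp add: C wedge_diff wedge_L M(1) wedge_smult algebra_simps)
  also have "\<dots> = 0"
    by (simp add: wedge_matrix wedge_L)
  finally have "wedge v (C *v x) = 0"
    using M(2) by simp
  then obtain j where "C *v x = j *s v"
    using wedge_eq_0_primitive[OF v(1)] by blast
  then show "L *v (C *v x) = l *s (C *v x)"
    by (simp add: matrix_vector_mult_smult v(2) mult.commute)
  have "C *v v = 0"
    by (simp add: C v(2) M(1) matrix_vector_mult_smult vec_eq_iff)
  obtain k where "L *v x - l' *s x = k *s v"
    using wedge_eq_0_primitive[OF v(1), of "L *v x - l' *s x"] 
    by (auto simp: wedge_diff wedge_L wedge_smult)
  then have "C *v (L *v x - l' *s x) = 0"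
    using \<open>C *v v = 0\<close> by (simp add: matrix_vector_mult_smult)
  then show "C *v (L *v x) = l' *s (C *v x)"
    by (simp add: matrix_vector_mult_diff_distrib matrix_vector_mult_smult)
qed

text \<open>Moving \<open>M\<close> past \<open>matrix_pow L m\<close> costs \<open>s *s (C *v x)\<close>, where \<open>s\<close> is the sum of the products
  \<open>l ^ i * l' ^ (m - 1 - i)\<close> over \<open>i < m\<close>. Some power of \<open>l'\<close> is divisible by \<open>l\<close>, so for large \<open>m\<close> each
  summand is divisible by \<open>l ^ n\<close>; and on the image of \<open>C\<close> multiplication by \<open>l ^ n\<close> is
  \<open>matrix_pow L n\<close>.\<close>

lemma lattice_compatible_if_line_stabilizer:
  fixes L M :: "int ^ 2 ^ 2"
  assumes v: "primitive v" "L *v v = l *s v" and l: "l \<noteq> 0" "det L = l * l'"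
    and primes: "\<And>p. prime p \<Longrightarrow> p dvd l \<Longrightarrow> p dvd l'"
    and M: "M \<in> line_stabilizer v"
  shows "lattice_compatible L M"
  unfolding lattice_compatible_def
proof
  fix n
  define C where "C = M ** L - L ** M"
  have "M *v v = 1 *s v \<or> M *v v = (- 1) *s v"
    using M by (auto simp: line_stabilizer_def vector_sneg_minus1[of v])
  then obtain e where e: "M *v v = e *s v" "e \<noteq> 0"
    by fastforce
  have L_C: "L *v (C *v x) = l *s (C *v x)" and C_L: "C *v (L *v x) = l' *s (C *v x)" for x
    using commutator_eigenvector[OF v l e] unfolding C_def by auto
  have M_L: "M *v (L *v x) = L *v (M *v x) + C *v x" for x
    by (simp add: C_def matrix_vector_mult_diff_rdistrib matrix_vector_mul_assoc)
  have L_pow: "matrix_pow L (Suc m) *v x = matrix_pow L m *v (L *v x)" for m x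
    by (simp add: matrix_pow_Suc2 matrix_vector_mul_assoc del: matrix_pow_Suc)
  \<comment> \<open>The step for \<open>?P\<close> is the recursion \<open>l ^ m + l' * s\<close> of the sum described above; only its
    divisibility matters, and the recursion shows it directly.\<close>
  let ?P = "\<lambda>m s. \<forall>x. M *v (matrix_pow L m *v x) = matrix_pow L m *v (M *v x) + s *s (C *v x)"
  have step: "?P (Suc m) (l ^ m + l' * s)" if "?P m s" for m s
  proof
    fix x
    have "M *v (matrix_pow L (Suc m) *v x) = matrix_pow L m *v (M *v (L *v x)) + s *s (C *v (L *v x))"
      using that unfolding L_pow by blast
    also have "\<dots> = matrix_pow L (Suc m) *v (M *v x) + (l ^ m + l' * s) *s (C *v x)"
      unfolding M_L C_L matrix_vector_right_distrib matrix_pow_eigenvector[OF L_C] L_pow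
      by (simp add: vec_eq_iff algebra_simps)
    finally show "M *v (matrix_pow L (Suc m) *v x) =
        matrix_pow L (Suc m) *v (M *v x) + (l ^ m + l' * s) *s (C *v x)" .
  qed
  have "\<exists>s. ?P m s" for m
  proof (induction m)
    case 0
    show ?case by (rule exI[of _ 0]) simp
  next
    case (Suc m)
    then show ?case using step by blast
  qed
  then obtain s where s: "?P n s" by blast
  have tail: "\<exists>a. ?P (n + j) (l ^ n * a + l' ^ j * s)" for j
  proof (induction j)
    case 0
    show ?case using s by (intro exI[of _ 0]) simp
  next
    case (Suc j)
    then obtain a where "?P (n + j) (l ^ n * a + l' ^ j * s)" ..
    from step[OF this] have "?P (n + Suc j) (l ^ n * (l ^ j + l' * a) + l' ^ Suc j * s)"
      by (simp add: power_add algebra_simps)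
    then show ?case ..
  qed
  obtain k where "l dvd l' ^ k"
    using dvd_power_if_prime_divisors[OF l(1) primes] by blast
  then have "l ^ n dvd l' ^ (k * n)"
    by (simp add: dvd_power_same power_mult)
  then obtain c where c: "l' ^ (k * n) = l ^ n * c" ..
  obtain a where a: "?P (n + k * n) (l ^ n * a + l' ^ (k * n) * s)"
    using tail by blast
  have "M *v (matrix_pow L (n + k * n) *v x) \<in> sublattice L n" for x
  proof -
    have "M *v (matrix_pow L (n + k * n) *v x) =
        matrix_pow L n *v (matrix_pow L (k * n) *v (M *v x)) + (a + c * s) *s (l ^ n *s (C *v x))"
      using a by (simp add: c matrix_pow_add matrix_vector_mul_assoc algebra_simps flip: matrix_mul_assoc)
    also have "l ^ n *s (C *v x) = matrix_pow L n *v (C *v x)"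
      by (rule matrix_pow_eigenvector[OF L_C, symmetric])
    finally show ?thesis
      unfolding sublattice_def
      by (simp flip: matrix_vector_mult_smult matrix_vector_right_distrib)
  qed
  then show "\<exists>m. \<forall>x \<in> sublattice L m. M *v x \<in> sublattice L n"
    unfolding sublattice_def by blast
qed

section \<open>The stabilizer of a line\<close>

text \<open>For \<open>w = v\<close> these are the transvections fixing \<open>v\<close>; for \<open>wedge v w = 1\<close> and \<open>c = - 2\<close> it is the
  reflection that fixes \<open>v\<close> and negates \<open>w\<close>.\<close>

definition rank_one_update :: "int ^ 2 \<Rightarrow> int \<Rightarrow> int ^ 2 \<Rightarrow> int ^ 2 ^ 2" where
  "rank_one_update v c w = (\<chi> i j. mat 1 $ i $ j + c * wedge v (axis j 1) * w $ i)"

lemma rank_one_update_mult: "rank_one_update v c w *v x = x + (c * wedge v x) *s w"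
  by (simp add: rank_one_update_def wedge_def matrix_2_simps axis_def algebra_simps)

abbreviation transvection :: "int ^ 2 \<Rightarrow> int \<Rightarrow> int ^ 2 ^ 2" where
  "transvection v k \<equiv> rank_one_update v k v"

lemma transvection_add: "transvection v a ** transvection v b = transvection v (a + b)"
  unfolding matrix_eq matrix_vector_mul_assoc[symmetric]
  by (simp add: rank_one_update_mult vec_eq_iff algebra_simps)

lemma transvection_0 [simp]: "transvection v 0 = mat 1"
  unfolding matrix_eq by (simp add: rank_one_update_mult)

lemma transvection_GL: "transvection v k \<in> carrier GL_int"
  unfolding carrier_GL_int invertible_def
  by (rule exI[of _ "transvection v (- k)"]) (simp add: transvection_add)

lemma inv_transvection: "inv\<^bsub>GL_int\<^esub> (transvection v k) = transvection v (- k)"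
  by (rule GL.inv_equality) (simp_all add: transvection_GL transvection_add)

lemma inj_transvection:
  assumes "primitive v"
  shows "inj (transvection v)"
proof (rule injI)
  fix a b assume eq: "transvection v a = transvection v b"
  obtain w where "wedge v w = 1"
    using assms by (rule primitive_Bezout)
  then have "w + a *s v = w + b *s v"
    using rank_one_update_mult[of v a v w] rank_one_update_mult[of v b v w] eq by simp
  then have "wedge (a *s v) w = wedge (b *s v) w"
    by simp
  then show "a = b"
    using \<open>wedge v w = 1\<close> by simp
qed

text \<open>In a basis that starts with \<open>v\<close>, such a matrix is upper unitriangular.\<close>

lemma transvectionI:
  assumes v: "primitive v" "M *v v = v" and det: "det M = 1"
  shows "\<exists>k. M = transvection v k"
proof -
  obtain w where w: "wedge v w = 1"
    using v(1) by (rule primitive_Bezout)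
  have "wedge v (M *v w - w) = wedge (M *v v) (M *v w) - wedge v w"
    by (simp add: v(2)) (simp add: wedge_def algebra_simps)
  also have "\<dots> = 0"
    unfolding wedge_matrix by (simp add: det)
  finally obtain k where k: "M *v w - w = k *s v"
    using wedge_eq_0_primitive[OF v(1)] by blast
  have "(M - transvection v k) *v v = 0"
    by (simp add: matrix_vector_mult_diff_rdistrib rank_one_update_mult v(2))
  moreover have "(M - transvection v k) *v w = 0"
    using k by (simp add: matrix_vector_mult_diff_rdistrib rank_one_update_mult w algebra_simps)
  ultimately have "M - transvection v k = 0"
    by (rule wedge_independent) (simp add: w)
  then show ?thesis
    by auto
qed

lemma subgroup_transvections: "subgroup (range (transvection v)) GL_int"
  by (rule GL.subgroupI) (auto simp: transvection_GL inv_transvection transvection_add)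

lemma int_subgroup_principal:
  fixes K :: "int set"
  assumes "0 \<in> K" "\<And>x y. x \<in> K \<Longrightarrow> y \<in> K \<Longrightarrow> x - y \<in> K"
  shows "\<exists>d. K = range ((*) d)"
proof -
  have "x \<in> K" if "x \<in> group_closure K" for x
    using that by induction (use assms in auto)
  then have "group_closure K = K"
    by (auto intro: group_closure.base)
  then show ?thesis
    using group_closure_eq[of K] by metis
qed

text \<open>The transvections along \<open>v\<close> form a homomorphic image of the integers, so their subgroups are cyclic.\<close>

lemma cyclic_group_transvections:
  assumes D: "subgroup D GL_int" "D \<subseteq> range (transvection v)"
  shows "cyclic_group (GL_int\<lparr>carrier := D\<rparr>)"
proof -
  define K where "K = {k. transvection v k \<in> D}"
  have "\<exists>d. K = range ((*) d)"
  proof (rule int_subgroup_principal)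
    show "0 \<in> K"
      using subgroup.one_closed[OF D(1)] by (simp add: K_def)
    fix x y assume xy: "x \<in> K" "y \<in> K"
    then have "transvection v x \<otimes>\<^bsub>GL_int\<^esub> inv\<^bsub>GL_int\<^esub> transvection v y \<in> D"
      using D(1) by (simp add: K_def subgroup.m_closed subgroup.m_inv_closed del: mult_GL_int)
    then show "x - y \<in> K"
      by (simp add: K_def inv_transvection transvection_add)
  qed
  then obtain d where d: "K = range ((*) d)" ..
  have "D = transvection v ` K"
    using D(2) by (auto simp: K_def)
  then have D_eq: "D = range (\<lambda>n. transvection v (d * n))"
    by (simp add: d image_image)
  have "(\<lambda>n. transvection v (d * n)) \<in> epi integer_group (GL_int\<lparr>carrier := D\<rparr>)"
    by (auto simp: epi_def hom_def D_eq transvection_add distrib_left)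
  then show ?thesis
    by (rule group.cyclic_group_epimorphic_image[OF group_integer_group _ cyclic_integer_group
          subgroup.subgroup_is_group[OF D(1) group_GL_int]])
qed

text \<open>The sign by which a matrix acts on \<open>v\<close> and its determinant are both multiplicative with
  commutative values, so they are trivial on commutators.\<close>

lemma commutator_line_stabilizer:
  assumes v: "primitive v" and a: "a \<in> line_stabilizer v" and b: "b \<in> line_stabilizer v"
  shows "a ** b ** inv\<^bsub>GL_int\<^esub> a ** inv\<^bsub>GL_int\<^esub> b \<in> range (transvection v)"
proof -
  have inv: "inv\<^bsub>GL_int\<^esub> M ** M = mat 1" "M ** inv\<^bsub>GL_int\<^esub> M = mat 1"
    if "M \<in> line_stabilizer v" for M
    using that GL.l_inv[of M] GL.r_inv[of M] by (auto simp: line_stabilizer_def)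
  have sign: "\<exists>e. e * e = 1 \<and> M *v v = e *s v \<and> (inv\<^bsub>GL_int\<^esub> M) *v v = e *s v"
    if M: "M \<in> line_stabilizer v" for M
  proof -
    have "M *v v = 1 *s v \<or> M *v v = (- 1) *s v"
      using M by (auto simp: line_stabilizer_def vector_sneg_minus1[of v])
    then obtain e where e: "e * e = 1" "M *v v = e *s v"
      by (metis minus_mult_minus mult_1)
    have "(inv\<^bsub>GL_int\<^esub> M) *v v = (e * e) *s ((inv\<^bsub>GL_int\<^esub> M) *v v)"
      by (simp add: e(1))
    also have "\<dots> = e *s ((inv\<^bsub>GL_int\<^esub> M) *v (M *v v))"
      by (simp add: e(2) matrix_vector_mult_smult)
    also have "\<dots> = e *s v"
      by (simp add: matrix_vector_mul_assoc inv[OF M])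
    finally show ?thesis
      using e by blast
  qed
  obtain e where e: "e * e = 1" "a *v v = e *s v" "(inv\<^bsub>GL_int\<^esub> a) *v v = e *s v"
    using sign[OF a] by blast
  obtain f where f: "f * f = 1" "b *v v = f *s v" "(inv\<^bsub>GL_int\<^esub> b) *v v = f *s v"
    using sign[OF b] by blast
  let ?c = "a ** b ** inv\<^bsub>GL_int\<^esub> a ** inv\<^bsub>GL_int\<^esub> b"
  have "?c *v v = (f * e * f * e) *s v"
    by (simp add: e(2,3) f(2,3) matrix_vector_mult_smult mult_ac flip: matrix_vector_mul_assoc)
  also have "f * e * f * e = (e * e) * (f * f)"
    by simp
  finally have "?c *v v = v"
    using e(1) f(1) by simp
  moreover have "det a * det (inv\<^bsub>GL_int\<^esub> a) = 1" "det b * det (inv\<^bsub>GL_int\<^esub> b) = 1"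
    using inv[OF a] inv[OF b] by (simp_all flip: det_mul)
  then have "(det a * det (inv\<^bsub>GL_int\<^esub> a)) * (det b * det (inv\<^bsub>GL_int\<^esub> b)) = 1"
    by simp
  then have "det ?c = 1"
    by (simp only: det_mul mult_ac)
  ultimately show ?thesis
    using transvectionI[OF v] by blast
qed

lemma derived_line_stabilizer:
  assumes v: "primitive v" and S: "subgroup S GL_int" "S \<subseteq> line_stabilizer v"
  shows "derived GL_int S \<subseteq> range (transvection v)"
  unfolding derived_def
proof (rule GL.generate_subgroup_incl[OF _ subgroup_transvections])
  show "derived_set GL_int S \<subseteq> range (transvection v)"
    using commutator_line_stabilizer[OF v] S(2) by auto
qed

text \<open>Conjugation by the reflection \<open>r\<close> inverts a transvection, so their commutator is the square of
  the transvection.\<close>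

lemma even_transvection_in_derived:
  assumes v: "primitive v" and S: "line_stabilizer v \<subseteq> S"
  shows "transvection v (2 * k) \<in> derived GL_int S"
proof -
  obtain w where w: "wedge v w = 1"
    using v by (rule primitive_Bezout)
  define r where "r = rank_one_update v (- 2) w"
  have r: "r *v x = x - (2 * wedge v x) *s w" for x
    by (simp add: r_def rank_one_update_mult vec_eq_iff)
  have rr: "r ** r = mat 1"
    unfolding matrix_eq matrix_vector_mul_assoc[symmetric]
    by (simp add: r_def rank_one_update_mult w vec_eq_iff algebra_simps)
  have r_GL: "r \<in> carrier GL_int"
    using rr by (auto simp: carrier_GL_int invertible_def)
  have inv_r: "inv\<^bsub>GL_int\<^esub> r = r"
    by (rule GL.inv_equality) (simp_all add: rr r_GL)
  have "r \<in> line_stabilizer v" "transvection v k \<in> line_stabilizer v"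
    using r_GL transvection_GL by (auto simp: line_stabilizer_def r rank_one_update_mult)
  then have "transvection v k \<otimes>\<^bsub>GL_int\<^esub> r \<otimes>\<^bsub>GL_int\<^esub> inv\<^bsub>GL_int\<^esub> transvection v k \<otimes>\<^bsub>GL_int\<^esub> inv\<^bsub>GL_int\<^esub> r
      \<in> derived_set GL_int S"
    using S by blast
  moreover have "transvection v k ** r ** transvection v (- k) ** r = transvection v (2 * k)"
    unfolding matrix_eq matrix_vector_mul_assoc[symmetric]
    by (simp only: r_def rank_one_update_mult wedge_add wedge_smult wedge_self w)
      (simp add: vec_eq_iff algebra_simps)
  ultimately show ?thesis
    unfolding derived_def by (simp add: inv_transvection inv_r generate.incl)
qed

text \<open>The modulus 4 separates the possible signs: the quotient \<open>t = a b\<^sup>-\<^sup>1\<close> is the identity modulo 4,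
  so it cannot negate the primitive vector \<open>v\<close> or have determinant \<open>-1\<close>. Hence it is a
  transvection, with a parameter divisible by 4.\<close>

lemma residue_mod_4_eq_imp_even_transvection:
  assumes v: "primitive v" and a: "a \<in> line_stabilizer v" and b: "b \<in> line_stabilizer v"
    and ab: "residue_matrix 4 a = residue_matrix 4 b"
  shows "\<exists>k. a = transvection v (2 * k) ** b"
proof -
  have GL: "a \<in> carrier GL_int" "b \<in> carrier GL_int"
    using a b by (auto simp: line_stabilizer_def)
  define b' where "b' = inv\<^bsub>GL_int\<^esub> b"
  have b': "b ** b' = mat 1" "b' ** b = mat 1"
    using GL.l_inv[OF GL(2)] GL.r_inv[OF GL(2)] by (auto simp: b'_def)
  obtain R where R: "\<And>x. a *v x = b *v x + 4 *s (R *v x)"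
    using residue_matrix_eqD[OF ab] by blast
  define t where "t = a ** b'"
  define Q where "Q = R ** b'"
  have t: "t *v x = x + 4 *s (Q *v x)" for x
    by (simp add: t_def Q_def R b' flip: matrix_vector_mul_assoc)
      (simp add: matrix_vector_mul_assoc b')
  have "t *v v = v \<or> t *v v = - v"
  proof -
    have "b' *v (b *v v) = v"
      by (simp add: matrix_vector_mul_assoc b')
    then have "b' *v v = v \<or> b' *v v = - v"
      using b by (auto simp: line_stabilizer_def matrix_vector_mult_uminus) (metis minus_minus)
    then show ?thesis
      using a by (auto simp: line_stabilizer_def t_def matrix_vector_mult_uminus
          simp flip: matrix_vector_mul_assoc)
  qed
  moreover have "t *v v \<noteq> - v"
  proof
    assume "t *v v = - v"
    then have "v $ i + 4 * (Q *v v) $ i = - v $ i" for i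
      using t[of v] by (metis vector_add_component vector_smult_component vector_uminus_component)
    then have "v $ i = 2 * (- (Q *v v) $ i)" for i
      by (smt (verit))
    then have "2 dvd v $ i" for i
      by (metis dvd_triv_left)
    then show False
      using v unfolding primitive_def by (meson coprime_common_divisor odd_one)
  qed
  ultimately have tv: "t *v v = v"
    by blast
  have "det t = 1"
  proof -
    have "t *v axis j 1 = axis j 1 + 4 *s (Q *v axis j 1)" for j
      by (rule t)
    from this[of 1] this[of 2]
    have "t $ 1 $ 1 = 1 + 4 * Q $ 1 $ 1" "t $ 2 $ 1 = 4 * Q $ 2 $ 1"
      "t $ 1 $ 2 = 4 * Q $ 1 $ 2" "t $ 2 $ 2 = 1 + 4 * Q $ 2 $ 2"
      by (simp_all add: matrix_2_simps axis_def)
    then have "det t = 1 + 4 * (Q $ 1 $ 1 + Q $ 2 $ 2 + 4 * (Q $ 1 $ 1 * Q $ 2 $ 2 - Q $ 1 $ 2 * Q $ 2 $ 1))"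
      by (simp add: det_2 algebra_simps)
    moreover have "invertible t"
      using GL GL.m_closed GL.inv_closed unfolding t_def b'_def
      by (metis carrier_GL_int mult_GL_int)
    then have "\<bar>det t\<bar> = 1"
      by (rule invertible_imp_det_unit)
    ultimately show ?thesis
      by presburger
  qed
  then obtain k where k: "t = transvection v k"
    using transvectionI[OF v tv] by blast
  obtain w where w: "wedge v w = 1"
    using v by (rule primitive_Bezout)
  have "k *s v = 4 *s (Q *v w)"
    using t[of w] by (simp add: k rank_one_update_mult w)
  then have "wedge (k *s v) w = wedge (4 *s (Q *v w)) w"
    by simp
  then have "k = 2 * (2 * wedge (Q *v w) w)"
    by (simp add: w)
  moreover have "a = t ** b"
    by (simp add: t_def b' flip: matrix_mul_assoc)
  ultimately show ?thesis
    using k by blast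
qed

lemma finite_rcosets_even_transvections:
  assumes v: "primitive v" and S: "S \<subseteq> line_stabilizer v"
    and D: "subgroup D GL_int" "\<And>k. transvection v (2 * k) \<in> D"
  shows "finite ((\<lambda>x. D #>\<^bsub>GL_int\<^esub> x) ` S)"
proof -
  let ?r = "residue_matrix 4 :: int ^ 2 ^ 2 \<Rightarrow> int ^ 2 ^ 2" and ?c = "\<lambda>x. D #>\<^bsub>GL_int\<^esub> x"
  have coset_eq: "?c a = ?c b" if ab: "a \<in> S" "b \<in> S" "?r a = ?r b" for a b
  proof -
    obtain k where a: "a = transvection v (2 * k) ** b"
      using residue_mod_4_eq_imp_even_transvection[OF v] ab S by blast
    have b: "b \<in> carrier GL_int"
      using ab S by (auto simp: line_stabilizer_def)
    have "?c a = (D #>\<^bsub>GL_int\<^esub> transvection v (2 * k)) #>\<^bsub>GL_int\<^esub> b"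
      using GL.coset_mult_assoc[OF subgroup.subset[OF D(1)] transvection_GL b] by (simp add: a)
    also have "D #>\<^bsub>GL_int\<^esub> transvection v (2 * k) = D"
      by (rule GL.coset_join2[OF transvection_GL D])
    finally show ?thesis .
  qed
  have "?c a = ?c (inv_into S ?r (?r a))" if a: "a \<in> S" for a
  proof (rule coset_eq[OF a])
    show "inv_into S ?r (?r a) \<in> S"
      by (rule inv_into_into) (rule imageI[OF a])
    show "?r a = ?r (inv_into S ?r (?r a))"
      by (rule f_inv_into_f[symmetric]) (rule imageI[OF a])
  qed
  then have "?c ` S \<subseteq> (\<lambda>y. ?c (inv_into S ?r y)) ` range ?r"
    by blast
  then show ?thesis
    by (rule finite_subset) (intro finite_imageI finite_range_residue_matrix, simp)
qed

lemma rcosets_GL_subgroup: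
  "rcosets\<^bsub>GL_int\<lparr>carrier := S\<rparr>\<^esub> D = (\<lambda>x. D #>\<^bsub>GL_int\<^esub> x) ` S"
  by (auto simp: RCOSETS_def r_coset_def)

lemma derived_GL_subgroup:
  assumes "subgroup S GL_int"
  shows "derived (GL_int\<lparr>carrier := S\<rparr>) (carrier (GL_int\<lparr>carrier := S\<rparr>)) = derived GL_int S"
  using GL.derived_consistent[OF order_refl assms] by simp

lemma subgroup_derived_GL: "subgroup S GL_int \<Longrightarrow> subgroup (derived GL_int S) GL_int"
  by (intro GL.derived_is_subgroup subgroup.subset)

lemma cyclic_commutator_subgroup_GL:
  assumes v: "primitive v" and S: "subgroup S GL_int" "S \<subseteq> line_stabilizer v"
  shows "cyclic_group (commutator_subgroup (GL_int\<lparr>carrier := S\<rparr>))"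
  unfolding commutator_subgroup_def derived_GL_subgroup[OF S(1)]
  using cyclic_group_transvections[OF subgroup_derived_GL[OF S(1)] derived_line_stabilizer[OF v S]]
  by simp

text \<open>The derived subgroup itself is the infinite cyclic subgroup of finite index: it consists of
  transvections and contains all the even ones.\<close>

lemma line_stabilizer_virtually_Z:
  assumes v: "primitive v" and S: "subgroup (line_stabilizer v) GL_int"
  defines "G \<equiv> GL_int\<lparr>carrier := line_stabilizer v\<rparr>"
  shows "virtually_Z G" and "finite (carrier (abelianization G))"
proof -
  define D where "D = derived GL_int (line_stabilizer v)"
  have D: "subgroup D GL_int" "D \<subseteq> line_stabilizer v" "D \<subseteq> range (transvection v)"
    and even: "\<And>k. transvection v (2 * k) \<in> D"
    using subgroup_derived_GL[OF S] GL.derived_incl[OF order_refl S]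
      derived_line_stabilizer[OF v S order_refl] even_transvection_in_derived[OF v order_refl]
    by (auto simp: D_def)
  have fin: "finite (rcosets\<^bsub>G\<^esub> D)"
    unfolding G_def rcosets_GL_subgroup
    by (rule finite_rcosets_even_transvections[OF v order_refl D(1) even])
  have "derived G (carrier G) = D"
    unfolding G_def D_def by (rule derived_GL_subgroup[OF S])
  then show "finite (carrier (abelianization G))"
    using fin by (simp add: abelianization_def FactGroup_def)
  have "inj (\<lambda>k. transvection v (2 * k))"
    using injD[OF inj_transvection[OF v]] by (fastforce intro: injI)
  then have "infinite (range (\<lambda>k. transvection v (2 * k)))"
    using finite_imageD infinite_UNIV_int by blast
  then have "infinite D"
    using even by (meson finite_subset image_subsetI)
  moreover have "subgroup D G"
    unfolding G_def by (rule GL.subgroup_incl[OF D(1) S D(2)])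
  moreover have "cyclic_group (G\<lparr>carrier := D\<rparr>)"
    using cyclic_group_transvections[OF D(1,3)] by (simp add: G_def)
  moreover have "group G"
    unfolding G_def by (rule subgroup.subgroup_is_group[OF S group_GL_int])
  ultimately show "virtually_Z G"
    unfolding virtually_Z_def using fin by blast
qed

lemma finite_two_line_stabilizers:
  assumes "wedge u v \<noteq> 0"
  shows "finite (line_stabilizer u \<inter> line_stabilizer v)"
proof (rule finite_imageD)
  let ?h = "\<lambda>M :: int ^ 2 ^ 2. (M *v u, M *v v)"
  have "?h ` (line_stabilizer u \<inter> line_stabilizer v) \<subseteq> {u, - u} \<times> {v, - v}"
    by (auto simp: line_stabilizer_def)
  then show "finite (?h ` (line_stabilizer u \<inter> line_stabilizer v))"
    by (rule finite_subset) simp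
  show "inj_on ?h (line_stabilizer u \<inter> line_stabilizer v)"
  proof (rule inj_onI)
    fix M N assume "?h M = ?h N"
    then have "M - N = 0"
      using wedge_independent[OF _ _ assms, of "M - N"]
      by (simp add: matrix_vector_mult_diff_rdistrib)
    then show "M = N"
      by simp
  qed
qed

section \<open>The linear representation group of a planar odometer\<close>

lemma odometer_linear_rep_2:
  fixes L :: "int ^ 2 ^ 2"
  assumes "det L \<noteq> 0"
  shows "odometer_linear_rep L = {M \<in> carrier GL_int. lattice_compatible L M}"
    and "subgroup (odometer_linear_rep L) GL_int"
proof -
  have "\<exists>q. q \<noteq> 0 \<and> (\<forall>x. q *s x \<in> sublattice L n)" for n
    using assms det_pow_in_sublattice by (intro exI[of _ "det L ^ n"]) auto
  then show "odometer_linear_rep L = {M \<in> carrier GL_int. lattice_compatible L M}"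
    and "subgroup (odometer_linear_rep L) GL_int"
    by (rule odometer_linear_rep_eq subgroup_odometer_linear_rep)+
qed

lemma primitive_eigenvector:
  fixes L :: "int ^ 2 ^ 2"
  assumes "is_eigenvalue L (of_int l)"
  obtains v where "primitive v" "L *v v = l *s v"
proof -
  have "det (L - mat l) = 0"
    using assms by (simp add: is_eigenvalue_of_int_iff matrix_2_simps algebra_simps)
  then obtain v where "primitive v" "(L - mat l) *v v = 0"
    using primitive_kernel by blast
  moreover have "(L - mat l) *v v = L *v v - l *s v"
    by (simp add: matrix_2_simps algebra_simps)
  ultimately show thesis
    using that by simp
qed

lemma odometer_linear_rep_subset_line_stabilizer:
  fixes L :: "int ^ 2 ^ 2"
  assumes det: "det L \<noteq> 0" and v: "primitive v" "L *v v = l *s v"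
    and p: "prime p" "p dvd det L" "\<not> p dvd l"
  shows "odometer_linear_rep L \<subseteq> line_stabilizer v"
proof
  fix M assume "M \<in> odometer_linear_rep L"
  then have "M \<in> carrier GL_int" "lattice_compatible L M"
    unfolding odometer_linear_rep_2(1)[OF det] by auto
  then show "M \<in> line_stabilizer v"
    using invertible_eigenvector_primitive[OF v(1) _ eigenvector_preserved[OF v(2) p]]
    by (simp add: line_stabilizer_def carrier_GL_int)
qed

text \<open>The prime \<open>p\<close> forces the linear representation group to stabilize the eigenline of \<open>l\<close>. If some prime divides \<open>l\<close>
  but not \<open>l'\<close>, then the group also stabilizes the eigenline of \<open>l'\<close>, which leaves at most four matrices.
  Otherwise nothing else is imposed, and the group is the full stabilizer of the line.\<close>

lemma odometer_linear_rep_integer_eigenvalues: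
  fixes L :: "int ^ 2 ^ 2"
  assumes det: "det L \<noteq> 0" and l: "trace L = l + l'" "det L = l * l'"
    and p: "prime p" "p dvd l'" "\<not> p dvd l"
  defines "G \<equiv> odometer_linear_rep_group L"
  shows "finite (carrier G) \<or> virtually_Z G"
    and "cyclic_group (commutator_subgroup G)" and "finite (carrier (abelianization G))"
proof -
  define N where "N = odometer_linear_rep L"
  have G: "G = GL_int\<lparr>carrier := N\<rparr>"
    by (simp add: G_def N_def odometer_linear_rep_group_def)
  have sub: "subgroup N GL_int"
    unfolding N_def by (rule odometer_linear_rep_2(2)[OF det])
  have "is_eigenvalue L (of_int l)" "is_eigenvalue L (of_int l')"
    by (simp_all add: is_eigenvalue_of_int_iff l algebra_simps)
  then obtain v v' where v: "primitive v" "L *v v = l *s v" and v': "primitive v'" "L *v v' = l' *s v'"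
    by (metis primitive_eigenvector)
  have N_v: "N \<subseteq> line_stabilizer v"
    unfolding N_def using p l(2) by (intro odometer_linear_rep_subset_line_stabilizer[OF det v]) auto
  show "cyclic_group (commutator_subgroup G)"
    unfolding G by (rule cyclic_commutator_subgroup_GL[OF v(1) sub N_v])
  have "(finite (carrier G) \<or> virtually_Z G) \<and> finite (carrier (abelianization G))"
  proof (cases "\<exists>p'. prime p' \<and> p' dvd l \<and> \<not> p' dvd l'")
    case True
    then obtain p' where p': "prime p'" "p' dvd l" "\<not> p' dvd l'" by blast
    have N_v': "N \<subseteq> line_stabilizer v'"
      unfolding N_def using p' l(2) by (intro odometer_linear_rep_subset_line_stabilizer[OF det v']) auto
    have "wedge v v' \<noteq> 0"
    proof
      assume "wedge v v' = 0"
      then obtain k where k: "v' = k *s v"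
        using wedge_eq_0_primitive[OF v(1)] by blast
      have "(l' - l) *s v' = l' *s v' - l *s v'"
        by (simp add: vec_eq_iff left_diff_distrib)
      also have "l *s v' = L *v v'"
        by (simp add: k v(2) matrix_vector_mult_smult mult.commute)
      finally have "(l' - l) *s v' = 0"
        using v'(2) by simp
      then have "l' = l"
        using primitive_nonzero[OF v'(1)] by (metis vector_mul_eq_0 eq_iff_diff_eq_0)
      then show False
        using p by blast
    qed
    then have "finite N"
      using finite_two_line_stabilizers N_v N_v' by (meson finite_subset le_inf_iff)
    then show ?thesis
      by (simp add: G abelianization_def FactGroup_def rcosets_GL_subgroup)
  next
    case False
    have "l \<noteq> 0"
      using det l(2) by auto
    then have "line_stabilizer v \<subseteq> N"
      using lattice_compatible_if_line_stabilizer[OF v _ l(2)] False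
      unfolding N_def odometer_linear_rep_2(1)[OF det] by (auto simp: line_stabilizer_def)
    then have "N = line_stabilizer v"
      using N_v by blast
    then show ?thesis
      using line_stabilizer_virtually_Z[OF v(1)] sub unfolding G by blast
  qed
  then show "finite (carrier G) \<or> virtually_Z G" "finite (carrier (abelianization G))"
    by blast+
qed

theorem theorem3p3:
  fixes L :: "int ^ 2 ^ 2"
  assumes "expansion L"
  defines "N \<equiv> odometer_linear_rep L"
    and "G \<equiv> odometer_linear_rep_group L"
  shows "(rad (det L) dvd trace L \<longrightarrow> N = carrier GL_int) \<and>
         (\<not> rad (det L) dvd trace L \<longrightarrow>
           (\<not> (\<exists>z. is_eigenvalue L z \<and> z \<in> \<int>) \<longrightarrow>
              N = Cent_GL L \<and>
              (\<not> (\<exists>z. is_eigenvalue L z \<and> z \<in> \<real>) \<longrightarrow> group G \<and> finite (carrier G))) \<and>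
           ((\<exists>z. is_eigenvalue L z \<and> z \<in> \<int>) \<longrightarrow>
              (group G \<and> finite (carrier G) \<or> virtually_Z G) \<and>
              (G \<cong> integer_mod_group 2 \<or>
               G \<cong> (integer_group \<times>\<times> integer_group) Mod (range ((*) 2) \<times> range ((*) 2)) \<or>
               cyclic_group (commutator_subgroup G) \<and> finite (carrier (abelianization G)))))"
proof -
  have det: "det L \<noteq> 0"
    using assms(1) by (rule expansion_imp_det_nonzero)
  have N_eq: "N = {M \<in> carrier GL_int. lattice_compatible L M}"
    unfolding N_def by (rule odometer_linear_rep_2(1)[OF det])
  have G_eq: "G = GL_int\<lparr>carrier := N\<rparr>"
    by (simp add: G_def N_def odometer_linear_rep_group_def)
  have group: "group G"
    unfolding G_eq N_def
    by (rule subgroup.subgroup_is_group[OF odometer_linear_rep_2(2)[OF det] group_GL_int])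
  have full: "N = carrier GL_int" if "rad (det L) dvd trace L"
    using lattice_compatible_if_rad_dvd_trace[OF det that] by (auto simp: N_eq)
  have p: "\<exists>p. prime p \<and> p dvd det L \<and> \<not> p dvd trace L" if "\<not> rad (det L) dvd trace L"
    using that rad_dvdI by blast
  have cent: "N = Cent_GL L"
    if "\<not> rad (det L) dvd trace L" "\<not> (\<exists>z. is_eigenvalue L z \<and> z \<in> \<int>)"
    using p[OF that(1)] commute_if_no_integer_eigenvalue[OF that(2) det_commutator_eq_0]
      lattice_compatible_if_commute
    unfolding N_eq Cent_GL_def by blast
  have int: "(finite (carrier G) \<or> virtually_Z G) \<and>
      cyclic_group (commutator_subgroup G) \<and> finite (carrier (abelianization G))"
    if rad: "\<not> rad (det L) dvd trace L" and eig: "\<exists>z. is_eigenvalue L z \<and> z \<in> \<int>"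
  proof -
    obtain l where l: "is_eigenvalue L (of_int l)"
      using eig Ints_cases by metis
    define l' where "l' = trace L - l"
    have tr: "trace L = l + l'" "trace L = l' + l" and det_eq: "det L = l * l'" "det L = l' * l"
      using l by (simp_all add: is_eigenvalue_of_int_iff l'_def algebra_simps)
    obtain p where p: "prime p" "p dvd l * l'" "\<not> p dvd l + l'"
      using p[OF rad] det_eq(1) tr(1) by auto
    then consider "p dvd l'" "\<not> p dvd l" | "p dvd l" "\<not> p dvd l'"
      by (metis dvd_add prime_dvd_mult_iff dvd_add_right_iff dvd_add_left_iff)
    then show ?thesis
    proof cases
      case 1
      then show ?thesis
        using odometer_linear_rep_integer_eigenvalues[OF det tr(1) det_eq(1) p(1)]
        unfolding G_def by blast
    next
      case 2
      then show ?thesis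
        using odometer_linear_rep_integer_eigenvalues[OF det tr(2) det_eq(2) p(1)]
        unfolding G_def by blast
    qed
  qed
  have fin: "finite (carrier G)"
    if "\<not> rad (det L) dvd trace L" "\<not> (\<exists>z. is_eigenvalue L z \<and> z \<in> \<int>)"
      "\<not> (\<exists>z. is_eigenvalue L z \<and> z \<in> \<real>)"
    using finite_Cent_GL[OF that(3)] cent[OF that(1,2)] by (simp add: G_eq)
  show ?thesis
    using full cent group fin int by blast
qed

end
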